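(* Let $n \ge 2$ and let $w \in \mathfrak{S}_n$ be a fully supported permutation. Then the following are equivalent: (i) there is a forced top-perimeter tile for $w$ (necessarily the tile $\{1,w(1)\}$); (ii) $w(1)$ and $1$ do not appear together in a $321$-pattern of $w$; (iii) the first left-to-right minimum of $w$ after $w(1)$ (reading left to right) is $1$.
   Context: Permutations are written in one-line notation $w = w(1)w(2)\cdots w(n)$. A permutation $w \in \mathfrak{S}_n$ is fully supported if $\{w(1),\ldots,w(r)\} \ne \{1,\ldots,r\}$ for all $1 \le r < n$ (equivalently, every simple reflection appears in its reduced decompositions). Elnitsky polygon. For fully supported $w \in \mathfrak{S}_n$, $n \ge 2$, Elnitsky's polygon $X(w)$ is the equilateral $2n$-gon whose sides, read counterclockwise starting at the top vertex, are labeled $1,\ldots,n,w(n),\ldots,w(1)$, such that the first $n$ sides form half of a convex $2n$-gon and sides with the same label are parallel. Concretely: fix unit vectors $v_1,\ldots,v_n$ in the plane with angles $\pi < \theta_1 < \cdots < \theta_n < 2\pi$; with the top vertex at the origin, the leftside boundary is the path with vertices $v_1+\cdots+v_k$ ($0\le k\le n$), its $k$th edge labeled $k$, and the rightside boundary is the path with vertices $v_{w(1)}+\cdots+v_{w(k)}$ ($0 \le k \le n$), its $k$th edge labeled $w(k)$. Both paths end at the bottom vertex, and $X(w)$ is the region they bound. The two edges at the top vertex are labeled $1$ and $w(1)$. Tilings. A rhombic tiling of $X(w)$ is an (edge-to-edge) tiling by rhombi whose edges are all congruent and parallel to edges of $X(w)$ (unit rhombi with sides parallel to $v_i$ and $v_j$,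 $i \ne j$). $T(w)$ is the set of all rhombic tilings of $X(w)$. The labels of a tile are the labels $\{i,j\}$ of the sides of $X(w)$ to which its edges are parallel. In any tiling no two tiles have the same labels, so a tile is identified with its label set: "the tile $\{x,y\}$". Perimeter tiles. A tile of $T \in T(w)$ is a top-perimeter tile if it has as edges the two edges of $X(w)$ on either side of the top vertex. The tile $\{x,y\}$ is a forced top-perimeter tile for $w$ if in every $T \in T(w)$ the tile $\{x,y\}$ is present and is a top-perimeter tile. Patterns. A $321$-pattern in $w$ is a triple of values $w(i)>w(j)>w(l)$ with $i<j<l$; two values appear together in a $321$-pattern if both belong to some such triple. A left-to-right minimum of $w$ is a value $w(i)$ with $w(i) < w(j)$ for all $j<i$ (so $w(1)$ is always one). *)

theory Defs
  imports "HOL-Analysis.Analysis" "HOL-Combinatorics.Permutations"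
begin

text \<open>Permutations of \<open>{1..n}\<close> are functions \<open>w\<close> with \<open>w permutes {1..n}\<close>; the one-line notation
  is \<open>w 1, ..., w n\<close>. The plane is \<^typ>\<open>complex\<close>, with \<open>v\<^sub>i = cis (\<theta> i)\<close>.\<close>

definition fully_supported :: "nat \<Rightarrow> (nat \<Rightarrow> nat) \<Rightarrow> bool" where
  "fully_supported n w \<longleftrightarrow> (\<forall>r. 1 \<le> r \<and> r < n \<longrightarrow> w ` {1..r} \<noteq> {1..r})"

definition elnitsky_angles :: "nat \<Rightarrow> (nat \<Rightarrow> real) \<Rightarrow> bool" where
  "elnitsky_angles n \<theta> \<longleftrightarrow> strict_mono_on {1..n} \<theta> \<and> \<theta> ` {1..n} \<subseteq> {pi<..<2*pi}"

text \<open>The lattice path with edge labels \<open>u 1, ..., u n\<close>, starting at the top vertex \<open>0\<close>. The leftside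
  boundary of the polygon is the case \<open>u = id\<close>, the rightside boundary the case \<open>u = w\<close>.\<close>

definition path_vertex :: "(nat \<Rightarrow> real) \<Rightarrow> (nat \<Rightarrow> nat) \<Rightarrow> nat \<Rightarrow> complex" where
  "path_vertex \<theta> u k = (\<Sum>i=1..k. cis (\<theta> (u i)))"

definition path_edge :: "(nat \<Rightarrow> real) \<Rightarrow> (nat \<Rightarrow> nat) \<Rightarrow> nat \<Rightarrow> complex set" where
  "path_edge \<theta> u k = closed_segment (path_vertex \<theta> u (k - 1)) (path_vertex \<theta> u k)"

definition elnitsky_sides :: "nat \<Rightarrow> (nat \<Rightarrow> real) \<Rightarrow> (nat \<Rightarrow> nat) \<Rightarrow> complex set set" where
  "elnitsky_sides n \<theta> w = path_edge \<theta> id ` {1..n} \<union> path_edge \<theta> w ` {1..n}"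

definition elnitsky_polygon :: "nat \<Rightarrow> (nat \<Rightarrow> real) \<Rightarrow> (nat \<Rightarrow> nat) \<Rightarrow> complex set" where
  "elnitsky_polygon n \<theta> w =
     \<Union> (elnitsky_sides n \<theta> w) \<union> inside (\<Union> (elnitsky_sides n \<theta> w))"

definition rhombus :: "(nat \<Rightarrow> real) \<Rightarrow> complex \<Rightarrow> nat \<Rightarrow> nat \<Rightarrow> complex set" where
  "rhombus \<theta> p i j =
     convex hull {p, p + cis (\<theta> i), p + cis (\<theta> j), p + cis (\<theta> i) + cis (\<theta> j)}"

definition tile_with_labels ::
  "nat \<Rightarrow> (nat \<Rightarrow> real) \<Rightarrow> complex set \<Rightarrow> nat \<Rightarrow> nat \<Rightarrow> bool" where
  "tile_with_labels n \<theta> S i j \<longleftrightarrow>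
     i \<in> {1..n} \<and> j \<in> {1..n} \<and> i \<noteq> j \<and> (\<exists>p. S = rhombus \<theta> p i j)"

text \<open>The last two conditions say that the tiling is edge-to-edge: two distinct tiles meet in a common
  face (nothing, a vertex or a whole edge), and the sides of the polygon are whole edges of tiles.
  For fully supported \<open>w\<close> the condition on the sides is a consequence of the others.\<close>

definition rhombic_tilings ::
  "nat \<Rightarrow> (nat \<Rightarrow> real) \<Rightarrow> (nat \<Rightarrow> nat) \<Rightarrow> complex set set set" where
  "rhombic_tilings n \<theta> w = {T.
     finite T \<and>
     (\<forall>S\<in>T. \<exists>i j. tile_with_labels n \<theta> S i j) \<and>
     \<Union> T = elnitsky_polygon n \<theta> w \<and>
     pairwise (\<lambda>A B. interior A \<inter> interior B = {}) T \<and>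
     pairwise (\<lambda>A B. (A \<inter> B) face_of A \<and> (A \<inter> B) face_of B) T \<and>
     (\<forall>e \<in> elnitsky_sides n \<theta> w. \<exists>S\<in>T. e edge_of S)}"

definition top_perimeter_tile ::
  "(nat \<Rightarrow> real) \<Rightarrow> (nat \<Rightarrow> nat) \<Rightarrow> complex set \<Rightarrow> bool" where
  "top_perimeter_tile \<theta> w S \<longleftrightarrow> path_edge \<theta> id 1 edge_of S \<and> path_edge \<theta> w 1 edge_of S"

definition forced_top_perimeter_tile ::
  "nat \<Rightarrow> (nat \<Rightarrow> real) \<Rightarrow> (nat \<Rightarrow> nat) \<Rightarrow> nat \<Rightarrow> nat \<Rightarrow> bool" where
  "forced_top_perimeter_tile n \<theta> w x y \<longleftrightarrow>
     (\<forall>T \<in> rhombic_tilings n \<theta> w.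
        \<exists>S\<in>T. tile_with_labels n \<theta> S x y \<and> top_perimeter_tile \<theta> w S)"

definition together_in_321 :: "nat \<Rightarrow> (nat \<Rightarrow> nat) \<Rightarrow> nat \<Rightarrow> nat \<Rightarrow> bool" where
  "together_in_321 n w a b \<longleftrightarrow>
     (\<exists>i j l. 1 \<le> i \<and> i < j \<and> j < l \<and> l \<le> n \<and> w i > w j \<and> w j > w l \<and>
        a \<in> {w i, w j, w l} \<and> b \<in> {w i, w j, w l})"

definition ltr_min_at :: "nat \<Rightarrow> (nat \<Rightarrow> nat) \<Rightarrow> nat \<Rightarrow> bool" where
  "ltr_min_at n w i \<longleftrightarrow> i \<in> {1..n} \<and> (\<forall>j. 1 \<le> j \<and> j < i \<longrightarrow> w i < w j)"

text \<open>The value \<open>m\<close> is the first left-to-right minimum of \<open>w\<close> strictly to the right of \<open>w 1\<close>.\<close>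

definition first_ltr_min_after_first :: "nat \<Rightarrow> (nat \<Rightarrow> nat) \<Rightarrow> nat \<Rightarrow> bool" where
  "first_ltr_min_after_first n w m \<longleftrightarrow>
     (\<exists>k>1. ltr_min_at n w k \<and> (\<forall>j. 1 < j \<and> j < k \<longrightarrow> \<not> ltr_min_at n w j) \<and> w k = m)"

end

theory Submission imports Defs begin

text \<open>
  In coordinates (depth below the top vertex, horizontal position) every path of unit edges is the
  graph of a piecewise linear function of the depth, and the polygon is the set of points between
  the graphs of the left and the right boundary. Exchanging two adjacent labels in increasing order
  pushes a path across one rhombus to the right.

  Going from the identity to \<open>w\<close> by such exchanges builds a rhombic tiling. If \<open>w 1\<close>, \<open>x\<close>, \<open>1\<close> is a
  \<open>321\<close>-pattern, the exchanges can be chosen to pass through a path that starts with a label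
  strictly between \<open>1\<close> and \<open>w 1\<close>, and the tile at the first left edge is then not \<open>{1, w 1}\<close>.

  Conversely, in any tiling every path of tile edges other than the right boundary can be pushed
  across a tile: a tile to the right of a path edge either hangs down from the edge or stands up
  from it; the first one hangs down, the last one cannot, and a tile hanging down
  followed by one standing up have a common left vertex, hence coincide. Along such a sweep from the
  left to the right boundary, the label \<open>x\<close> of the tile \<open>{1, x}\<close> at the first left edge moves in
  front of \<open>1\<close> and stays there, so \<open>x \<noteq> w 1\<close> yields a \<open>321\<close>-pattern.
\<close>

section \<open>Permutations\<close>

text \<open>All \<open>v i\<close> point strictly downwards, so depth increases along every path and
  can serve as its parameter; comparing labels then amounts to comparing slopes. The polygon is
  given through \<open>inside\<close> and has to be identified with the set between two graphs
  before anything can be said about its tiles.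

  Two obstacles shape the rest. A tiling is an unstructured set of convex bodies; sweeping it rests
  on the edge-to-edge condition, by which a tile that contains an inner point of another tile's edge
  has this whole edge as an edge of its own. And a path on its way from the identity to
  \<open>w\<close> may still share edges with the left boundary, where nothing lies between them;
  full support ensures that at the end no edge belongs to both boundaries.

  Both directions come down to one comparison: the label \<open>x\<close> of the tile
  \<open>{1, x}\<close> at the first left edge is at most \<open>w 1\<close>, and
  \<open>x < w 1\<close> occurs in some tiling exactly when an entry below \<open>w 1\<close> stands
  between \<open>w 1\<close> and \<open>1\<close>.\<close>

lemma together_in_321_first_one_iff:
  assumes "w permutes {1..n}" and "w 1 \<noteq> 1" and "n \<ge> 1"
  shows "together_in_321 n w (w 1) 1 \<longleftrightarrow>
    (\<exists>j l. 1 < j \<and> j < l \<and> l \<le> n \<and> w l = 1 \<and> w j < w 1)"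
proof
  have inj: "w a = w b \<longleftrightarrow> a = b" for a b
    using permutes_inj[OF assms(1)] by (auto dest: injD)
  have ge: "w a \<ge> 1" if "1 \<le> a" "a \<le> n" for a
    using permutes_in_image[OF assms(1), of a] that by auto
  {
    assume "together_in_321 n w (w 1) 1"
    then obtain i j l where h: "1 \<le> i" "i < j" "j < l" "l \<le> n" "w i > w j" "w j > w l"
      "w 1 \<in> {w i, w j, w l}" "1 \<in> {w i, w j, w l}"
      unfolding together_in_321_def by blast
    \<comment> \<open>By injectivity position 1 is among \<open>i\<close>, \<open>j\<close>,
      \<open>l\<close>, hence the leftmost; likewise the least value can only come last.\<close>
    have "i = 1" using h inj by auto
    moreover have "w l = 1"
      using h ge[of l] ge[of j] by auto
    ultimately show "\<exists>j l. 1 < j \<and> j < l \<and> l \<le> n \<and> w l = 1 \<and> w j < w 1"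
      using h by (intro exI[of _ j] exI[of _ l]) auto
  }
  assume "\<exists>j l. 1 < j \<and> j < l \<and> l \<le> n \<and> w l = 1 \<and> w j < w 1"
  then obtain j l where h: "1 < j" "j < l" "l \<le> n" "w l = 1" "w j < w 1" by blast
  have "w j \<noteq> 1" using inj[of j l] h by auto
  then have "w j > w l" using ge[of j] h by auto
  then show "together_in_321 n w (w 1) 1"
    unfolding together_in_321_def using h by (intro exI[of _ 1] exI[of _ j] exI[of _ l]) auto
qed

text \<open>Both sides say that no entry strictly between position 1 and the value 1 is below
  \<open>w 1\<close>, because the first entry below \<open>w 1\<close> is automatically a
  left-to-right minimum.\<close>

lemma not_together_in_321_iff_first_ltr_min:
  assumes "w permutes {1..n}" and "w 1 \<noteq> 1" and "n \<ge> 1"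
  shows "\<not> together_in_321 n w (w 1) 1 \<longleftrightarrow> first_ltr_min_after_first n w 1"
proof -
  have inj: "w a = w b \<longleftrightarrow> a = b" for a b
    using permutes_inj[OF assms(1)] by (auto dest: injD)
  have ge: "w a \<ge> 1" if "1 \<le> a" "a \<le> n" for a
    using permutes_in_image[OF assms(1), of a] that by auto
  have "1 \<in> w ` {1..n}" using permutes_image[OF assms(1)] assms(3) by auto
  then obtain l where l: "1 \<le> l" "l \<le> n" "w l = 1" by auto
  have l1: "l > 1" using l assms(2) by (cases "l = 1") auto
  show ?thesis
  proof
    assume a: "\<not> together_in_321 n w (w 1) 1"
    have big: "w j \<ge> w 1" if "1 < j" "j < l" for j
      using a that l unfolding together_in_321_first_one_iff[OF assms]
      by (meson not_le)
    have gt1: "1 < w j" if "1 \<le> j" "j < l" for j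
      using ge[of j] inj[of j l] l that by (cases "w j = 1") auto
    have "ltr_min_at n w l" using l gt1 unfolding ltr_min_at_def by auto
    moreover have "\<not> ltr_min_at n w j" if "1 < j" "j < l" for j
      using big[OF that] that unfolding ltr_min_at_def by (auto simp: not_less intro!: exI[of _ 1])
    ultimately show "first_ltr_min_after_first n w 1"
      unfolding first_ltr_min_after_first_def using l l1 by blast
  next
    assume "first_ltr_min_after_first n w 1"
    then obtain k where k: "k > 1" "\<And>j. 1 < j \<Longrightarrow> j < k \<Longrightarrow> \<not> ltr_min_at n w j" "w k = 1"
      unfolding first_ltr_min_after_first_def by blast
    have kl: "k = l" using inj[of k l] k l by auto
    show "\<not> together_in_321 n w (w 1) 1"
    proof
      assume "together_in_321 n w (w 1) 1"
      then obtain j where j: "1 < j" "j < l" "w j < w 1"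
        unfolding together_in_321_first_one_iff[OF assms] using inj l by metis
      \<comment> \<open>The least such position carries a left-to-right minimum, and it comes before
        the value 1.\<close>
      define P where "P i \<longleftrightarrow> 1 < i \<and> w i < w 1" for i
      have P: "P (LEAST i. P i)" by (rule LeastI[of P j]) (use j in \<open>auto simp: P_def\<close>)
      have le: "(LEAST i. P i) \<le> j" by (rule Least_le) (use j in \<open>auto simp: P_def\<close>)
      have nl: "w (LEAST i. P i) < w i" if "1 \<le> i" "i < (LEAST i. P i)" for i
        using not_less_Least[OF that(2)] P that by (cases "i = 1") (auto simp: P_def not_less)
      then have "ltr_min_at n w (LEAST i. P i)"
        using P le j l unfolding ltr_min_at_def P_def by auto
      then show False using k(2)[of "LEAST i. P i"] P le j kl by (auto simp: P_def)
    qed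
  qed
qed

section \<open>Adjacent exchanges and a measure for them\<close>

abbreviation swap_adj :: "(nat \<Rightarrow> 'a) \<Rightarrow> nat \<Rightarrow> nat \<Rightarrow> 'a" where
  "swap_adj u k \<equiv> u \<circ> Transposition.transpose k (Suc k)"

lemma swap_adj_simps:
  "swap_adj u k k = u (Suc k)" "swap_adj u k (Suc k) = u k"
  "i \<noteq> k \<Longrightarrow> i \<noteq> Suc k \<Longrightarrow> swap_adj u k i = u i"
  by (auto simp: Transposition.transpose_def)

text \<open>Termination measure of both inductions along exchanges: exchanging an ascent lowers it
  by exactly \<open>u (Suc k) - u k\<close>.\<close>

definition label_moment :: "nat \<Rightarrow> (nat \<Rightarrow> nat) \<Rightarrow> nat" where
  "label_moment n u = (\<Sum>k=1..n. k * u k)"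

lemma label_moment_swap:
  assumes "1 \<le> k" "k < n"
  shows "label_moment n (swap_adj u k) + u (Suc k) = label_moment n u + u k"
proof -
  have s: "{1..n} = insert k (insert (Suc k) ({1..n} - {k, Suc k}))" using assms by auto
  have "(\<Sum>i\<in>{1..n} - {k, Suc k}. i * swap_adj u k i) = (\<Sum>i\<in>{1..n} - {k, Suc k}. i * u i)"
    by (rule sum.cong) (auto simp: Transposition.transpose_def)
  then show ?thesis
    unfolding label_moment_def by (subst (1 2) s) (simp add: algebra_simps)
qed

lemma permutes_swap:
  assumes "u permutes {1..n}" "1 \<le> k" "k < n"
  shows "swap_adj u k permutes {1..n}"
  by (rule permutes_compose[OF permutes_swap_id]) (use assms in auto)

lemma label_moment_le:
  assumes "u permutes {1..n}"
  shows "label_moment n u \<le> n * (n * n)"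
proof -
  have "k * u k \<le> n * n" if "k \<in> {1..n}" for k
    using permutes_in_image[OF assms, of k] that by (intro mult_mono) auto
  then have "(\<Sum>k=1..n. k * u k) \<le> of_nat (card {1..n}) * (n * n)" by (rule sum_bounded_above)
  then show ?thesis by (simp add: label_moment_def)
qed

lemma permutes_no_descent_id:
  fixes u :: "nat \<Rightarrow> nat"
  assumes u: "u permutes {1..n}" and no: "\<And>k. 1 \<le> k \<Longrightarrow> k < n \<Longrightarrow> u k < u (Suc k)"
  shows "u = id"
proof (rule permutes_natset_ge[OF u], rule ballI)
  fix i assume "i \<in> {1..n}"
  then have "1 \<le> i" "i \<le> n" by auto
  then show "i \<le> u i"
  proof (induction i rule: dec_induct)
    case base
    then show ?case using permutes_in_image[OF u, of 1] by auto
  next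
    case (step m)
    then show ?case using no[of m] by auto
  qed
qed

text \<open>Induction along the weak order: a permutation other than \<open>id\<close> has a
  descent, and undoing it raises the moment. The cubic bound on the moment turns this growth into a
  decreasing natural number.\<close>

lemma permutes_ascent_induct [consumes 1, case_names id swap]:
  fixes u :: "nat \<Rightarrow> nat"
  assumes "u permutes {1..n}" and "P id"
    and step: "\<And>u k. u permutes {1..n} \<Longrightarrow> P u \<Longrightarrow> 1 \<le> k \<Longrightarrow> k < n \<Longrightarrow> u k < u (Suc k)
      \<Longrightarrow> P (swap_adj u k)"
  shows "P u"
  using assms(1)
proof (induction "n * (n * n) - label_moment n u" arbitrary: u rule: less_induct)
  case less
  show ?case
  proof (cases "u = id")
    case False
    then obtain k where k: "1 \<le> k" "k < n" "u (Suc k) \<le> u k"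
      using permutes_no_descent_id[OF less.prems] by (meson not_less)
    then have k': "u (Suc k) < u k"
      using permutes_inj[OF less.prems] by (metis injD le_neq_implies_less n_not_Suc_n)
    define u0 where "u0 = swap_adj u k"
    have u0: "u0 permutes {1..n}" unfolding u0_def using permutes_swap less.prems k by blast
    have "label_moment n u < label_moment n u0"
      using label_moment_swap[OF k(1,2), of u] k' unfolding u0_def by linarith
    then have "P u0" using less.hyps[OF _ u0] label_moment_le[OF u0] by linarith
    from step[OF u0 this k(1,2)] k' have "P (swap_adj u0 k)"
      by (simp add: u0_def)
    then show ?thesis by (simp add: u0_def comp_assoc)
  qed (use assms in simp)
qed

section \<open>Rhombi with prescribed edge directions\<close>

text \<open>The line at height \<open>h\<close> supports both sets from opposite sides and meets
  each at most in \<open>q\<close>, so a nonempty intersection is a vertex of both. This serves a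
  new tile and the path edges wholly above or below it.\<close>

lemma face_of_touching_heights:
  assumes "convex A" "convex B" and "\<And>z. z \<in> A \<Longrightarrow> Im z \<ge> h" "\<And>z. z \<in> B \<Longrightarrow> Im z \<le> h"
    and "\<And>z. z \<in> A \<Longrightarrow> Im z = h \<Longrightarrow> z = q" "\<And>z. z \<in> B \<Longrightarrow> Im z = h \<Longrightarrow> z = q"
  shows "(A \<inter> B) face_of A \<and> (A \<inter> B) face_of B"
proof (cases "A \<inter> B = {}")
  case False
  then obtain z where z: "z \<in> A" "z \<in> B" by auto
  have sub: "x = q \<and> Im x = h" if "x \<in> A" "x \<in> B" for x
  proof -
    have "Im x = h" using assms(3,4)[of x] that by simp
    then show ?thesis using assms(5) that by blast
  qed
  have q: "q \<in> A" "q \<in> B" "Im q = h" using sub z by metis+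
  have "A \<inter> B = A \<inter> {x. \<i> \<bullet> x = h}" "A \<inter> B = B \<inter> {x. \<i> \<bullet> x = h}"
    unfolding complex_inner_i_left using sub q assms(5,6) by blast+
  moreover have "(A \<inter> {x. \<i> \<bullet> x = h}) face_of A"
    using face_of_Int_supporting_hyperplane_ge[of A h \<i>] assms(1,3) by simp
  moreover have "(B \<inter> {x. \<i> \<bullet> x = h}) face_of B"
    using face_of_Int_supporting_hyperplane_le[of B \<i> h] assms(2,4) by simp
  ultimately show ?thesis by metis
qed simp

lemma endpoint_face_of_segment:
  "{a} face_of closed_segment a b" "{b} face_of closed_segment a (b :: 'a :: euclidean_space)"
  by (auto simp: face_of_singleton extreme_point_of_segment)

locale elnitsky =
  fixes n :: nat and \<theta> :: "nat \<Rightarrow> real"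
  assumes angles: "elnitsky_angles n \<theta>"
begin

abbreviation v :: "nat \<Rightarrow> complex" where "v i \<equiv> cis (\<theta> i)"

definition s :: "nat \<Rightarrow> real" where "s i = - sin (\<theta> i)"

text \<open>Horizontal displacement per unit of depth along \<open>v i\<close>, that is, minus the
  cotangent of \<open>\<theta> i\<close>. It increases between pi and 2 pi, so the order of labels
  is the order of slopes.\<close>

definition c :: "nat \<Rightarrow> real" where "c i = cos (\<theta> i) / s i"

lemma s_pos: "i \<in> {1..n} \<Longrightarrow> s i > 0"
  using angles sin_lt_zero[of "\<theta> i"] unfolding elnitsky_angles_def s_def by fastforce

lemma Im_v: "Im (v i) = - s i" by (simp add: s_def)

lemma Re_v: "i \<in> {1..n} \<Longrightarrow> Re (v i) = c i * s i"
  using s_pos[of i] by (simp add: c_def)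

lemma c_less:
  assumes "i \<in> {1..n}" "j \<in> {1..n}" "i < j"
  shows "c i < c j"
proof -
  have "\<theta> i < \<theta> j" "pi < \<theta> i" "\<theta> j < 2 * pi"
    using assms angles strict_mono_onD[of "{1..n}" \<theta> i j]
    unfolding elnitsky_angles_def image_subset_iff greaterThanLessThan_iff by blast+
  then have "sin (\<theta> j - \<theta> i) > 0" by (intro sin_gt_zero) auto
  then have "cos (\<theta> i) * s j < cos (\<theta> j) * s i"
    by (simp add: sin_diff s_def algebra_simps)
  then show ?thesis
    using s_pos[OF assms(1)] s_pos[OF assms(2)] by (simp add: c_def divide_simps mult.commute)
qed

lemma c_less_iff:
  assumes "i \<in> {1..n}" "j \<in> {1..n}"
  shows "c i < c j \<longleftrightarrow> i < j"
  using c_less[of i j] c_less[of j i] assms by (metis linorder_neqE_nat order_less_asym)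

lemma c_eq_iff:
  assumes "i \<in> {1..n}" "j \<in> {1..n}"
  shows "c i = c j \<longleftrightarrow> i = j"
  using c_less_iff[OF assms] c_less_iff[OF assms(2,1)] by (metis linorder_neqE_nat order_less_irrefl)

lemma v_eq_iff:
  assumes "i \<in> {1..n}" "j \<in> {1..n}"
  shows "v i = v j \<longleftrightarrow> i = j"
proof
  assume "v i = v j"
  then have "Im (v i) = Im (v j)" "Re (v i) = Re (v j)" by metis+
  then have "s i = s j" "c i * s i = c j * s j"
    unfolding Im_v Re_v[OF assms(1)] Re_v[OF assms(2)] by auto
  then show "i = j" using s_pos[OF assms(1)] c_eq_iff[OF assms] by auto
qed simp

text \<open>The linear functional whose level sets are the lines parallel to \<open>v i\<close>; it increases to the
  right.\<close>

definition off :: "nat \<Rightarrow> complex \<Rightarrow> real" where "off i z = Re z + c i * Im z"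

lemma off_inner: "off i z = Complex 1 (c i) \<bullet> z"
  by (simp add: off_def inner_complex_def)

lemma off_simps [simp]:
  "off i (x + y) = off i x + off i y" "off i (x - y) = off i x - off i y" "off i (- x) = - off i x"
  "off i (r *\<^sub>R x) = r * off i x" "off i (complex_of_real r) = r" "off i 0 = 0"
  by (simp_all add: off_def algebra_simps)

lemma off_v: "j \<in> {1..n} \<Longrightarrow> off i (v j) = s j * (c j - c i)"
  by (simp add: off_def Re_v Im_v del: cis.simps) (simp add: algebra_simps)

lemma off_v_self [simp]: "i \<in> {1..n} \<Longrightarrow> off i (v i) = 0"
  by (simp add: off_v)

lemma off_gap: "i \<in> {1..n} \<Longrightarrow> j \<in> {1..n} \<Longrightarrow> i < j \<Longrightarrow> s i * (c j - c i) > 0 \<and> s j * (c j - c i) > 0"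
  using s_pos c_less by simp

lemma segment_iff:
  assumes "i \<in> {1..n}"
  shows "z \<in> closed_segment p (p + v i) \<longleftrightarrow> off i z = off i p \<and> Im p - s i \<le> Im z \<and> Im z \<le> Im p"
proof
  assume "z \<in> closed_segment p (p + v i)"
  then obtain t where t: "0 \<le> t" "t \<le> 1" "z = p + t *\<^sub>R v i"
    unfolding closed_segment_def by (auto simp: algebra_simps)
  have "t * s i \<le> s i" "0 \<le> t * s i" using t s_pos[OF assms] by (auto simp: mult_left_le_one_le)
  then show "off i z = off i p \<and> Im p - s i \<le> Im z \<and> Im z \<le> Im p"
    using assms t(3) Im_v[of i] by simp
next
  assume a: "off i z = off i p \<and> Im p - s i \<le> Im z \<and> Im z \<le> Im p"
  define t where "t = (Im p - Im z) / s i"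
  have t: "0 \<le> t" "t \<le> 1" using a s_pos[OF assms] by (auto simp: t_def divide_simps)
  have "Im z = Im (p + t *\<^sub>R v i)" using s_pos[OF assms] by (simp add: t_def Im_v del: cis.simps)
  moreover have "off i z = off i (p + t *\<^sub>R v i)" using a assms by simp
  ultimately have "z = p + t *\<^sub>R v i" unfolding off_def by (simp add: complex_eq_iff)
  then have "z = (1 - t) *\<^sub>R p + t *\<^sub>R (p + v i)" by (simp add: algebra_simps)
  then show "z \<in> closed_segment p (p + v i)" unfolding closed_segment_def using t by blast
qed

text \<open>Every \<open>v i\<close> points downwards, so the starting point is the highest point of
  the segment; the direction then gives the label.\<close>

lemma segment_eqD:
  assumes "m \<in> {1..n}" "j \<in> {1..n}" "closed_segment p (p + v m) = closed_segment q (q + v j)"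
  shows "p = q" "m = j"
proof -
  have P: "p \<in> closed_segment q (q + v j)" "p + v m \<in> closed_segment q (q + v j)"
    unfolding assms(3)[symmetric] by simp_all
  have Q: "q \<in> closed_segment p (p + v m)" "q + v j \<in> closed_segment p (p + v m)"
    unfolding assms(3) by simp_all
  have Im: "Im p = Im q" using P Q unfolding segment_iff[OF assms(1)] segment_iff[OF assms(2)] by auto
  have "off j p = off j q" using P(1) unfolding segment_iff[OF assms(2)] by simp
  then show pq: "p = q" using Im by (simp add: off_def complex_eq_iff)
  have "off j (p + v m) = off j q" using P(2) unfolding segment_iff[OF assms(2)] by simp
  then have "s m * (c m - c j) = 0" unfolding pq using off_v[OF assms(1), of j] by simp
  then show "m = j" using s_pos[OF assms(1)] c_eq_iff[OF assms(1,2)] by simp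
qed

lemma rhombus_commute: "rhombus \<theta> p i j = rhombus \<theta> p j i"
  unfolding rhombus_def by (simp add: insert_commute add_ac)

lemma convex_rhombus: "convex (rhombus \<theta> p i j)" and closed_rhombus: "closed (rhombus \<theta> p i j)"
  unfolding rhombus_def by (auto simp: compact_imp_closed compact_convex_hull)

lemma convex_off: "convex {z. a \<le> off i z \<and> off i z \<le> b}"
proof -
  have "{z. a \<le> off i z \<and> off i z \<le> b} =
    {z. Complex 1 (c i) \<bullet> z \<ge> a} \<inter> {z. Complex 1 (c i) \<bullet> z \<le> b}"
    by (auto simp: off_inner)
  then show ?thesis by (simp add: convex_Int convex_halfspace_ge convex_halfspace_le)
qed

text \<open>A rhombus is the intersection of two strips. Each functional annihilates the direction
  of its own label and so measures the position across one strip.\<close>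

lemma rhombus_iff:
  assumes "i \<in> {1..n}" "j \<in> {1..n}" "i < j"
  shows "z \<in> rhombus \<theta> p i j \<longleftrightarrow>
    0 \<le> off i (z - p) \<and> off i (z - p) \<le> s j * (c j - c i) \<and>
    off j (z - p) \<le> 0 \<and> - s i * (c j - c i) \<le> off j (z - p)"
    (is "_ \<longleftrightarrow> ?R z")
proof
  note gap = off_gap[OF assms]
  have "rhombus \<theta> p i j \<subseteq> {z. off i p \<le> off i z \<and> off i z \<le> off i p + s j * (c j - c i)}"
    unfolding rhombus_def using gap assms by (intro hull_minimal convex_off) (auto simp: off_v)
  moreover have "rhombus \<theta> p i j \<subseteq> {z. off j p - s i * (c j - c i) \<le> off j z \<and> off j z \<le> off j p}"
    unfolding rhombus_def using gap assms
    by (intro hull_minimal convex_off) (auto simp: off_v algebra_simps)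
  moreover assume "z \<in> rhombus \<theta> p i j"
  ultimately show "?R z" by auto
next
  note gap = off_gap[OF assms]
  assume R: "?R z"
  \<comment> \<open>The coefficients of \<open>z - p\<close> in the basis \<open>v i\<close>,
    \<open>v j\<close>: \<open>off j\<close> kills \<open>v j\<close> and isolates the coefficient
    of \<open>v i\<close>, and conversely.\<close>
  define a where "a = - off j (z - p) / (s i * (c j - c i))"
  define b where "b = off i (z - p) / (s j * (c j - c i))"
  have a: "0 \<le> a" "a \<le> 1" unfolding a_def using R gap by (auto simp: divide_simps)
  have b: "0 \<le> b" "b \<le> 1" unfolding b_def using R gap by (auto simp: divide_simps)
  define y where "y = p + a *\<^sub>R v i + b *\<^sub>R v j"
  have nz: "s j * (c j - c i) \<noteq> 0" "s i * (c j - c i) \<noteq> 0" using gap by linarith+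
  have "b * (s j * (c j - c i)) = off i (z - p)"
    using nonzero_eq_divide_eq[OF nz(1)] b_def by blast
  then have "off i y = off i z" unfolding y_def using assms by (simp add: off_v)
  moreover have "a * (s i * (c j - c i)) = - off j (z - p)"
    using nonzero_eq_divide_eq[OF nz(2)] a_def by blast
  then have "off j y = off j z" unfolding y_def using assms by (simp add: off_v algebra_simps)
  ultimately have "(c j - c i) * Im y = (c j - c i) * Im z" "Re y + c i * Im y = Re z + c i * Im z"
    unfolding off_def by (simp_all add: algebra_simps)
  then have yz: "y = z" using c_less[OF assms] by (simp add: complex_eq_iff)
  have V: "{p, p + v i, p + v j, p + v i + v j} \<subseteq> rhombus \<theta> p i j"
    unfolding rhombus_def by (rule hull_subset)
  have q1: "(1 - a) *\<^sub>R p + a *\<^sub>R (p + v i) \<in> rhombus \<theta> p i j"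
    using V a by (intro convexD[OF convex_rhombus]) auto
  have q2: "(1 - a) *\<^sub>R (p + v j) + a *\<^sub>R (p + v i + v j) \<in> rhombus \<theta> p i j"
    using V a by (intro convexD[OF convex_rhombus]) auto
  have "(1 - b) *\<^sub>R ((1 - a) *\<^sub>R p + a *\<^sub>R (p + v i)) +
    b *\<^sub>R ((1 - a) *\<^sub>R (p + v j) + a *\<^sub>R (p + v i + v j)) \<in> rhombus \<theta> p i j"
    using b by (intro convexD[OF convex_rhombus q1 q2]) auto
  also have "(1 - b) *\<^sub>R ((1 - a) *\<^sub>R p + a *\<^sub>R (p + v i)) +
    b *\<^sub>R ((1 - a) *\<^sub>R (p + v j) + a *\<^sub>R (p + v i + v j)) = y"
    unfolding y_def by (simp add: algebra_simps)
  finally show "z \<in> rhombus \<theta> p i j" unfolding yz .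
qed

text \<open>The difference of the two strip coordinates is a positive multiple of the height
  relative to \<open>p\<close>, so the strips bound the height, and an extreme height pins both
  coordinates.\<close>

lemma rhombus_Im:
  assumes "i \<in> {1..n}" "j \<in> {1..n}" "i < j" "z \<in> rhombus \<theta> p i j"
  shows "Im p - s i - s j \<le> Im z" "Im z \<le> Im p"
    "Im z = Im p \<Longrightarrow> z = p" "Im z = Im p - s i - s j \<Longrightarrow> z = p + v i + v j"
proof -
  have R: "0 \<le> off i (z - p)" "off i (z - p) \<le> s j * (c j - c i)"
    "off j (z - p) \<le> 0" "- s i * (c j - c i) \<le> off j (z - p)"
    using assms(4) unfolding rhombus_iff[OF assms(1-3)] by auto
  have d: "off j (z - p) - off i (z - p) = (c j - c i) * (Im z - Im p)"
    by (simp add: off_def algebra_simps)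
  have cc: "c j - c i > 0" using c_less[OF assms(1-3)] by simp
  have "(c j - c i) * (- s i - s j) \<le> (c j - c i) * (Im z - Im p)"
    using R d by (simp add: algebra_simps)
  then show "Im p - s i - s j \<le> Im z" using cc by (simp add: mult_le_cancel_left_pos)
  have "(c j - c i) * (Im z - Im p) \<le> (c j - c i) * 0" using R d by simp
  then show "Im z \<le> Im p" using cc mult_le_cancel_left_pos[of "c j - c i" "Im z - Im p" 0] by simp
  {
    assume "Im z = Im p"
    then have "off j (z - p) = off i (z - p)" using d by simp
    then have "off i (z - p) = 0" using R by simp
    then show "z = p" using \<open>Im z = Im p\<close> by (simp add: off_def complex_eq_iff)
  }
  assume b: "Im z = Im p - s i - s j"
  then have "off j (z - p) - off i (z - p) = - s i * (c j - c i) - s j * (c j - c i)"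
    unfolding d b by (simp add: algebra_simps)
  then have "off i (z - p) = s j * (c j - c i)" using R by linarith
  then have "off i z = off i (p + v i + v j)" using assms by (simp add: off_v)
  then show "z = p + v i + v j" using b by (simp add: off_def complex_eq_iff Im_v del: cis.simps)
qed

text \<open>Equal sets have the same highest and the same lowest point. This fixes the sum of the
  two edge vectors; a label known to be common then yields the other one.\<close>

lemma rhombus_eqD:
  assumes "i \<in> {1..n}" "j \<in> {1..n}" "i < j" and "k \<in> {1..n}" "l \<in> {1..n}" "k < l"
    and "rhombus \<theta> p i j = rhombus \<theta> q k l"
  shows "p = q" and "p + v i + v j = q + v k + v l"
proof -
  have V: "p \<in> rhombus \<theta> p i j" "q \<in> rhombus \<theta> q k l" "p + v i + v j \<in> rhombus \<theta> p i j"
     "q + v k + v l \<in> rhombus \<theta> q k l"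
    unfolding rhombus_def by (auto intro: hull_inc)
  note A = rhombus_Im[OF assms(1-3)] and B = rhombus_Im[OF assms(4-6)]
  have "Im p = Im q" using A(2)[of q p] B(2)[of p q] V assms(7) by auto
  then show pq: "p = q" using A(3)[of q p] V assms(7) by auto
  have "Im (q + v k + v l) \<ge> Im (p + v i + v j)" "Im (q + v k + v l) \<le> Im (p + v i + v j)"
    using A(1)[of "q + v k + v l" p] B(1)[of "p + v i + v j" q] V assms(7)
    by (auto simp: Im_v simp del: cis.simps)
  then show "p + v i + v j = q + v k + v l" 
    using A(4)[of "q + v k + v l" p] V assms(7) by (auto simp: Im_v simp del: cis.simps)
qed

text \<open>For \<open>i < j\<close> the vertex \<open>p + v i\<close> is the left one. A shift to
  the right raises both functionals by the same amount, so the two strip widths bound how far it may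
  go.\<close>

lemma left_vertex_interior:
  assumes "i \<in> {1..n}" "j \<in> {1..n}" "i < j"
  shows "\<exists>\<delta>>0. \<forall>e. 0 < e \<and> e < \<delta> \<longrightarrow> p + v i + complex_of_real e \<in> interior (rhombus \<theta> p i j)"
proof (intro exI[of _ "min (s j * (c j - c i)) (s i * (c j - c i))"] conjI allI impI)
  note gap = off_gap[OF assms]
  then show "0 < min (s j * (c j - c i)) (s i * (c j - c i))" by simp
  fix e assume e: "0 < e \<and> e < min (s j * (c j - c i)) (s i * (c j - c i))"
  define U where "U = {z. 0 < off i (z - p)} \<inter> {z. off i (z - p) < s j * (c j - c i)} \<inter>
    {z. off j (z - p) < 0} \<inter> {z. - s i * (c j - c i) < off j (z - p)}"
  have "open U" unfolding U_def off_def
    by (intro open_Int open_Collect_less continuous_intros)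
  moreover have "U \<subseteq> rhombus \<theta> p i j" unfolding U_def using rhombus_iff[OF assms] by auto
  moreover have "p + v i + complex_of_real e \<in> U"
    unfolding U_def using e assms by (auto simp: off_v) (auto simp: algebra_simps)
  ultimately show "p + v i + complex_of_real e \<in> interior (rhombus \<theta> p i j)"
    by (meson interior_maximal subsetD)
qed

lemma rhombi_common_left_vertex:
  assumes "i \<in> {1..n}" "j \<in> {1..n}" "i < j" and "k \<in> {1..n}" "l \<in> {1..n}" "k < l"
    and "p + v i = q + v k"
  shows "interior (rhombus \<theta> p i j) \<inter> interior (rhombus \<theta> q k l) \<noteq> {}"
proof -
  obtain d1 where d1: "d1 > 0" "\<And>e. 0 < e \<Longrightarrow> e < d1 \<Longrightarrow> p + v i + complex_of_real e \<in> interior (rhombus \<theta> p i j)"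
    using left_vertex_interior[OF assms(1-3)] by meson
  obtain d2 where d2: "d2 > 0" "\<And>e. 0 < e \<Longrightarrow> e < d2 \<Longrightarrow> q + v k + complex_of_real e \<in> interior (rhombus \<theta> q k l)"
    using left_vertex_interior[OF assms(4-6)] by meson
  define e where "e = min d1 d2 / 2"
  have e: "0 < e" "e < d1" "e < d2" using d1(1) d2(1) by (auto simp: e_def)
  show ?thesis using d1(2)[OF e(1,2)] d2(2)[OF e(1,3)] unfolding assms(7) by blast
qed

lemma rhombus_edges:
  assumes "i \<in> {1..n}" "j \<in> {1..n}" "i < j"
  shows "closed_segment p (p + v i) edge_of rhombus \<theta> p i j"
    and "closed_segment (p + v i) (p + v i + v j) edge_of rhombus \<theta> p i j"
    and "closed_segment p (p + v j) edge_of rhombus \<theta> p i j"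
    and "closed_segment (p + v j) (p + v j + v i) edge_of rhombus \<theta> p i j"
proof -
  note gap = off_gap[OF assms]
  let ?R = "rhombus \<theta> p i j"
  have dim: "aff_dim (closed_segment q (q + v k)) = 1" for q k
    by (simp add: segment_convex_hull aff_dim_convex_hull aff_dim_2)
  have edgeI: "closed_segment q (q + v k) edge_of ?R"
    if "closed_segment q (q + v k) = X" "X face_of ?R" for q k X
    using that dim[of q k] by (simp add: edge_of_def)
  have F: "(?R \<inter> {z. off k z = b}) face_of ?R"
    if "(\<forall>z\<in>?R. off k z \<le> b) \<or> (\<forall>z\<in>?R. off k z \<ge> b)" for k b
    using that unfolding off_inner
    by (metis convex_rhombus face_of_Int_supporting_hyperplane_ge face_of_Int_supporting_hyperplane_le)
  have d: "off j (z - p) - off i (z - p) = (c j - c i) * (Im z - Im p)" for z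
    by (simp add: off_def algebra_simps)
  have cc: "c j - c i > 0" using c_less[OF assms(1-3)] by simp
  \<comment> \<open>Translates the height bounds of \<open>segment_iff\<close> into bounds on the
    two functionals; the four set equalities below become linear arithmetic.\<close>
  have lin: "t \<le> Im z - Im p \<longleftrightarrow> (c j - c i) * t \<le> off j (z - p) - off i (z - p)"
    "Im z - Im p \<le> t \<longleftrightarrow> off j (z - p) - off i (z - p) \<le> (c j - c i) * t" for t z
    unfolding d using cc by (simp_all only: mult_le_cancel_left_pos)
  note iff = rhombus_iff[OF assms]
  have "closed_segment p (p + v i) = ?R \<inter> {z. off i z = off i p}"
  proof (intro set_eqI)
    fix z
    show "z \<in> closed_segment p (p + v i) \<longleftrightarrow> z \<in> ?R \<inter> {z. off i z = off i p}"
      using gap lin(1)[of "- s i" z] lin(2)[of z "0"]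
      unfolding segment_iff[OF assms(1)] Int_iff iff mem_Collect_eq
      by (simp add: off_v[OF assms(1)] off_v[OF assms(2)] Im_v algebra_simps del: cis.simps) linarith?
  qed
  then show "closed_segment p (p + v i) edge_of ?R"
    by (rule edgeI) (rule F, auto simp: iff)
  have "closed_segment p (p + v j) = ?R \<inter> {z. off j z = off j p}"
  proof (intro set_eqI)
    fix z
    show "z \<in> closed_segment p (p + v j) \<longleftrightarrow> z \<in> ?R \<inter> {z. off j z = off j p}"
      using gap lin(1)[of "- s j" z] lin(2)[of z "0"]
      unfolding segment_iff[OF assms(2)] Int_iff iff mem_Collect_eq
      by (simp add: off_v[OF assms(1)] off_v[OF assms(2)] Im_v algebra_simps del: cis.simps) linarith?
  qed
  then show "closed_segment p (p + v j) edge_of ?R"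
    by (rule edgeI) (rule F, auto simp: iff)
  have "closed_segment (p + v i) (p + v i + v j) = ?R \<inter> {z. off j z = off j (p + v i)}"
  proof (intro set_eqI)
    fix z
    show "z \<in> closed_segment (p + v i) (p + v i + v j) \<longleftrightarrow> z \<in> ?R \<inter> {z. off j z = off j (p + v i)}"
      using gap lin(1)[of "- s i - s j" z] lin(2)[of z "- s i"]
      unfolding segment_iff[OF assms(2)] Int_iff iff mem_Collect_eq
      by (simp add: off_v[OF assms(1)] off_v[OF assms(2)] Im_v algebra_simps del: cis.simps) linarith?
  qed
  then show "closed_segment (p + v i) (p + v i + v j) edge_of ?R"
    by (rule edgeI) (rule F, auto simp: iff off_v[OF assms(1)] algebra_simps)
  have "closed_segment (p + v j) (p + v j + v i) = ?R \<inter> {z. off i z = off i (p + v j)}"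
  proof (intro set_eqI)
    fix z
    show "z \<in> closed_segment (p + v j) (p + v j + v i) \<longleftrightarrow> z \<in> ?R \<inter> {z. off i z = off i (p + v j)}"
      using gap lin(1)[of "- s i - s j" z] lin(2)[of z "- s j"]
      unfolding segment_iff[OF assms(1)] Int_iff iff mem_Collect_eq
      by (simp add: off_v[OF assms(1)] off_v[OF assms(2)] Im_v algebra_simps del: cis.simps) linarith?
  qed
  then show "closed_segment (p + v j) (p + v j + v i) edge_of ?R"
    by (rule edgeI) (rule F, auto simp: iff off_v[OF assms(2)] algebra_simps)
qed

text \<open>The endpoints of an edge are extreme points, hence vertices. Diagonals drop out because
  their common midpoint would drag the other diagonal into the face, and reversed sides because
  \<open>v m\<close> points down.\<close>

lemma rhombus_edge_cases:
  assumes "i \<in> {1..n}" "j \<in> {1..n}" "i < j" and "m \<in> {1..n}"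
    and "closed_segment a (a + v m) edge_of rhombus \<theta> p i j"
  shows "m = i \<and> (a = p \<or> a = p + v j) \<or> m = j \<and> (a = p \<or> a = p + v i)"
proof -
  let ?e = "closed_segment a (a + v m)" and ?R = "rhombus \<theta> p i j"
  have F: "?e face_of ?R" using assms(5) by (simp add: edge_of_def)
  have ext: "x \<in> {p, p + v i, p + v j, p + v i + v j}" if "x = a \<or> x = a + v m" for x
  proof -
    have "x extreme_point_of ?e" using that by (auto simp: extreme_point_of_segment)
    then have "x extreme_point_of ?R" using F by (simp add: extreme_point_of_face)
    then show ?thesis unfolding rhombus_def by (rule extreme_point_of_convex_hull)
  qed
  have V: "{p, p + v i, p + v j, p + v i + v j} \<subseteq> ?R"
    unfolding rhombus_def by (rule hull_subset)
  have mid: "a' \<in> ?e" if "a' \<in> ?R" "b' \<in> ?R" "a' \<noteq> b'" "midpoint a' b' \<in> ?e" for a' b'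
    using F that unfolding face_of_def by (meson midpoint_in_open_segment)
  have mide: "midpoint a (a + v m) \<in> ?e" by simp
  have sp: "s i > 0" "s j > 0" "s m > 0" using s_pos assms by auto
  have center: "midpoint p (p + v i + v j) = midpoint (p + v i) (p + v j)"
    by (simp add: midpoint_def algebra_simps)
  have ne: "p \<noteq> p + v i + v j" "p + v i \<noteq> p + v j"
    using v_eq_iff[OF assms(1,2)] assms(3) Im_v[of i] Im_v[of j] sp
    by (auto simp: complex_eq_iff simp del: cis.simps)
  have all4: "p + v i \<in> ?e \<and> p + v j \<in> ?e \<and> p \<in> ?e"
    if h: "midpoint (p + v i) (p + v j) \<in> ?e"
  proof (intro conjI)
    show "p \<in> ?e" by (rule mid[of p "p + v i + v j"]) (use V ne center h in auto)
    show "p + v i \<in> ?e" by (rule mid[of "p + v i" "p + v j"]) (use V ne h in auto)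
    show "p + v j \<in> ?e"
      by (rule mid[of "p + v j" "p + v i"]) (use V ne h midpoint_sym[of "p + v i"] in auto)
  qed
  \<comment> \<open>A segment has a single direction, but this one would contain steps along both
    \<open>v i\<close> and \<open>v j\<close>.\<close>
  have no4: "midpoint (p + v i) (p + v j) \<notin> ?e"
  proof
    assume "midpoint (p + v i) (p + v j) \<in> ?e"
    from all4[OF this] have "off m (v i) = 0" "off m (v j) = 0"
      unfolding segment_iff[OF assms(4)] by (simp_all del: cis.simps)
    then have "c i = c m" "c j = c m"
      using sp unfolding off_v[OF assms(1)] off_v[OF assms(2)] by auto
    then show False using c_less[OF assms(1-3)] by simp
  qed
  have ia: "a \<in> {p, p + v i, p + v j, p + v i + v j}" and
    ib: "a + v m \<in> {p, p + v i, p + v j, p + v i + v j}" using ext by auto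
  have bad: "False" if "midpoint a (a + v m) = midpoint (p + v i) (p + v j)"
    using no4 mide that by simp
  have up: "v m \<noteq> x" if "Im x > - s m" for x using that Im_v[of m] by auto
  have I: "Im (v i) = - s i" "Im (v j) = - s j" by (rule Im_v)+
  consider "a = p" | "a = p + v i" | "a = p + v j" | "a = p + v i + v j" using ia by blast
  then show ?thesis
  proof cases
    case 1
    have "v m \<noteq> 0" by simp
    moreover have "v m \<noteq> v i + v j" using bad center unfolding 1 by (metis add.assoc)
    moreover have "v m \<in> {0, v i, v j, v i + v j}"
      using ib unfolding 1 insert_iff add.assoc add_left_cancel by simp
    ultimately have "v m = v i \<or> v m = v j" by blast
    then show ?thesis unfolding v_eq_iff[OF assms(4,1)] v_eq_iff[OF assms(4,2)] using 1 by blast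
  next
    case 2
    have "v m \<noteq> - v i" "v m \<noteq> 0" using I sp by (auto intro!: up simp del: cis.simps)
    moreover have "v m \<noteq> v j - v i"
    proof
      assume "v m = v j - v i"
      then have "a + v m = p + v j" unfolding 2 by simp
      then show False by (intro bad) (simp only: 2)
    qed
    moreover have "v m \<in> {- v i, 0, v j - v i, v j}"
      using ib unfolding 2 by (auto simp: algebra_simps eq_neg_iff_add_eq_0)
    ultimately have "v m = v j" by blast
    then show ?thesis unfolding v_eq_iff[OF assms(4,2)] using 2 by blast
  next
    case 3
    have "v m \<noteq> - v j" "v m \<noteq> 0" using I sp by (auto intro!: up simp del: cis.simps)
    moreover have "v m \<noteq> v i - v j"
    proof
      assume "v m = v i - v j"
      then have "a + v m = p + v i" unfolding 3 by simp
      then show False by (intro bad) (simp only: 3 midpoint_sym)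
    qed
    moreover have "v m \<in> {- v j, 0, v i - v j, v i}"
      using ib unfolding 3 by (auto simp: algebra_simps eq_neg_iff_add_eq_0)
    ultimately have "v m = v i" by blast
    then show ?thesis unfolding v_eq_iff[OF assms(4,1)] using 3 by blast
  next
    case 4
    have "v m \<noteq> - v i - v j" "v m \<noteq> - v i" "v m \<noteq> - v j" "v m \<noteq> 0"
      using I sp by (auto intro!: up simp del: cis.simps)
    moreover have "v m \<in> {- v i - v j, - v i, - v j, 0}"
      using ib unfolding 4 by (auto simp: algebra_simps eq_neg_iff_add_eq_0)
    ultimately show ?thesis by blast
  qed
qed

section \<open>Paths and the polygon\<close>

abbreviation pv :: "(nat \<Rightarrow> nat) \<Rightarrow> nat \<Rightarrow> complex" where "pv \<equiv> path_vertex \<theta>"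

abbreviation pe :: "(nat \<Rightarrow> nat) \<Rightarrow> nat \<Rightarrow> complex set" where "pe \<equiv> path_edge \<theta>"

definition depth :: "(nat \<Rightarrow> nat) \<Rightarrow> nat \<Rightarrow> real" where "depth u k = (\<Sum>i=1..k. s (u i))"

definition H :: real where "H = (\<Sum>i=1..n. s i)"

text \<open>\<open>xpos u t\<close> is the real part of the point at depth \<open>t\<close> below the top vertex on the path with
  labels \<open>u\<close>.\<close>

definition xpos :: "(nat \<Rightarrow> nat) \<Rightarrow> real \<Rightarrow> real" where
  "xpos u t = (\<Sum>k=1..n. c (u k) * max 0 (min (s (u k)) (t - depth u (k - 1))))"

lemma permutes_label: "u permutes {1..n} \<Longrightarrow> k \<in> {1..n} \<Longrightarrow> u k \<in> {1..n}"
  using permutes_in_image by metis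

lemma pv_0 [simp]: "pv u 0 = 0" and pv_Suc: "pv u (Suc k) = pv u k + v (u (Suc k))"
  by (simp_all add: path_vertex_def)

lemma depth_0 [simp]: "depth u 0 = 0" and depth_Suc: "depth u (Suc k) = depth u k + s (u (Suc k))"
  by (simp_all add: depth_def)

lemma pv_pred: "k \<ge> 1 \<Longrightarrow> pv u k = pv u (k - 1) + v (u k)"
  using pv_Suc[of u "k - 1"] by simp

lemma depth_pred: "k \<ge> 1 \<Longrightarrow> depth u k = depth u (k - 1) + s (u k)"
  using depth_Suc[of u "k - 1"] by simp

lemma pe_eq: "k \<ge> 1 \<Longrightarrow> pe u k = closed_segment (pv u (k - 1)) (pv u (k - 1) + v (u k))"
  by (simp add: path_edge_def pv_pred)

lemma Im_pv: "Im (pv u k) = - depth u k"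
  by (induction k) (simp_all add: pv_Suc depth_Suc Im_v del: cis.simps)

lemma depth_mono:
  assumes "u permutes {1..n}" "k \<le> l" "l \<le> n"
  shows "depth u k \<le> depth u l"
  using assms(2,3)
proof (induction l rule: dec_induct)
  case (step m)
  then show ?case using s_pos[OF permutes_label[OF assms(1), of "Suc m"]] by (simp add: depth_Suc)
qed simp

lemma depth_less:
  assumes "u permutes {1..n}" "k < l" "l \<le> n"
  shows "depth u k < depth u l"
proof -
  have "depth u k < depth u (Suc k)"
    using s_pos[OF permutes_label[OF assms(1), of "Suc k"]] assms by (simp add: depth_Suc)
  also have "\<dots> \<le> depth u l" using depth_mono assms by simp
  finally show ?thesis .
qed

lemma depth_n: "u permutes {1..n} \<Longrightarrow> depth u n = H"
  unfolding depth_def H_def using sum.permute[of u "{1..n}" s] by (simp add: comp_def)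

lemma depth_bounds:
  assumes "u permutes {1..n}" "k \<le> n"
  shows "0 \<le> depth u k" "depth u k \<le> H"
  using depth_mono[of u 0 k] depth_mono[of u k n] depth_n[of u] assms by auto

lemma Re_pv:
  assumes "u permutes {1..n}" "k \<le> n"
  shows "Re (pv u k) = (\<Sum>i=1..k. c (u i) * s (u i))"
  using assms(2)
proof (induction k)
  case (Suc k)
  then show ?case using Re_v[OF permutes_label[OF assms(1), of "Suc k"]]
    by (simp add: pv_Suc del: cis.simps)
qed simp

text \<open>At a depth on the \<open>k\<close>th edge the clamped terms of the earlier edges are
  saturated and those of the later edges vanish.\<close>

lemma xpos_piece:
  assumes u: "u permutes {1..n}" and k: "k \<in> {1..n}"
    and t: "depth u (k - 1) \<le> t" "t \<le> depth u k"
  shows "xpos u t = Re (pv u (k - 1)) + c (u k) * (t - depth u (k - 1))"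
proof -
  have split: "{1..n} = {1..k-1} \<union> ({k} \<union> {Suc k..n})" using k by auto
  let ?f = "\<lambda>l. c (u l) * max 0 (min (s (u l)) (t - depth u (l - 1)))"
  have 1: "(\<Sum>l=1..k-1. ?f l) = (\<Sum>l=1..k-1. c (u l) * s (u l))"
  proof (rule sum.cong[OF refl])
    fix l assume l: "l \<in> {1..k-1}"
    then have "l \<in> {1..n}" using k by auto
    then have "s (u l) > 0" using s_pos permutes_label[OF u] by blast
    moreover have "depth u l \<le> depth u (k - 1)" using l k depth_mono[OF u, of l "k - 1"] by auto
    moreover have "depth u l = depth u (l - 1) + s (u l)" using l depth_pred by auto
    ultimately show "?f l = c (u l) * s (u l)" using t by simp
  qed
  have 2: "(\<Sum>l=Suc k..n. ?f l) = 0"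
  proof (rule sum.neutral, rule ballI)
    fix l assume l: "l \<in> {Suc k..n}"
    then have "depth u k \<le> depth u (l - 1)" using depth_mono[OF u, of k "l - 1"] by auto
    then show "?f l = 0" using t by simp
  qed
  have 3: "?f k = c (u k) * (t - depth u (k - 1))"
    using t depth_pred[of k u] k by simp
  have "xpos u t = (\<Sum>l=1..k-1. ?f l) + (?f k + (\<Sum>l=Suc k..n. ?f l))"
    unfolding xpos_def split by (subst sum.union_disjoint, simp, simp, force)+ simp
  also have "\<dots> = Re (pv u (k - 1)) + c (u k) * (t - depth u (k - 1))"
    unfolding 1 2 3 using Re_pv[OF u, of "k - 1"] k by (simp add: le_diff_conv)
  finally show ?thesis .
qed

lemma pv_xpos:
  assumes "u permutes {1..n}" "k \<le> n" "n \<ge> 1"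
  shows "Re (pv u k) = xpos u (depth u k)"
proof (cases k)
  case 0
  then show ?thesis using xpos_piece[OF assms(1), of 1 0] assms depth_bounds[of u 1] by simp
next
  case (Suc m)
  then show ?thesis
    using xpos_piece[OF assms(1), of k "depth u k"] assms depth_pred[of k u] pv_pred[of k u]
      Re_v[OF permutes_label[OF assms(1), of k]] s_pos[OF permutes_label[OF assms(1), of k]]
    by (simp del: cis.simps)
qed

lemma pe_iff:
  assumes u: "u permutes {1..n}" and k: "k \<in> {1..n}"
  shows "z \<in> pe u k \<longleftrightarrow> depth u (k - 1) \<le> - Im z \<and> - Im z \<le> depth u k \<and> Re z = xpos u (- Im z)"
proof -
  have k1: "k \<ge> 1" using k by simp
  have "z \<in> pe u k \<longleftrightarrow> off (u k) z = off (u k) (pv u (k - 1)) \<and>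
      depth u (k - 1) \<le> - Im z \<and> - Im z \<le> depth u k"
    unfolding pe_eq[OF k1] segment_iff[OF permutes_label[OF u k]] Im_pv depth_pred[OF k1] by auto
  moreover have "off (u k) z = off (u k) (pv u (k - 1)) \<longleftrightarrow>
    Re z = Re (pv u (k - 1)) + c (u k) * (- Im z - depth u (k - 1))"
    by (auto simp: off_def Im_pv algebra_simps)
  ultimately show ?thesis using xpos_piece[OF u k, of "- Im z"] by auto
qed

lemma depth_cover:
  assumes u: "u permutes {1..n}" and n: "n \<ge> 1" and t: "0 \<le> t" "t \<le> H"
  obtains k where "k \<in> {1..n}" "depth u (k - 1) \<le> t" "t \<le> depth u k"
proof -
  define k where "k = (LEAST k. 1 \<le> k \<and> t \<le> depth u k)"
  have ex: "1 \<le> n \<and> t \<le> depth u n" using depth_n[OF u] t n by simp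
  have k: "1 \<le> k \<and> t \<le> depth u k" unfolding k_def by (rule LeastI, rule ex)
  have kn: "k \<le> n" unfolding k_def by (rule Least_le, rule ex)
  have "depth u (k - 1) \<le> t"
  proof (cases "k = 1")
    case False
    have "\<not> (1 \<le> k - 1 \<and> t \<le> depth u (k - 1))"
      unfolding k_def by (rule not_less_Least) (use k k_def in linarith)
    then show ?thesis using False k by linarith
  qed (use t in simp)
  then show ?thesis using that[of k] k kn by simp
qed

lemma path_iff:
  assumes u: "u permutes {1..n}" and n: "n \<ge> 1"
  shows "z \<in> (\<Union>k\<in>{1..n}. pe u k) \<longleftrightarrow> 0 \<le> - Im z \<and> - Im z \<le> H \<and> Re z = xpos u (- Im z)"
proof
  assume "z \<in> (\<Union>k\<in>{1..n}. pe u k)"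
  then obtain k where k: "k \<in> {1..n}" "z \<in> pe u k" by auto
  then show "0 \<le> - Im z \<and> - Im z \<le> H \<and> Re z = xpos u (- Im z)"
    using depth_bounds[OF u, of "k - 1"] depth_bounds[OF u, of k]
    unfolding pe_iff[OF u k(1)] by (simp, linarith?)
next
  assume a: "0 \<le> - Im z \<and> - Im z \<le> H \<and> Re z = xpos u (- Im z)"
  then obtain k where "k \<in> {1..n}" "depth u (k - 1) \<le> - Im z" "- Im z \<le> depth u k"
    using depth_cover[OF u n, of "- Im z"] by blast
  then show "z \<in> (\<Union>k\<in>{1..n}. pe u k)" using a pe_iff[OF u] by blast
qed

lemma xpos_ends:
  assumes "u permutes {1..n}" "n \<ge> 1"
  shows "xpos u 0 = 0" and "xpos u H = (\<Sum>i=1..n. c i * s i)"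
proof -
  show "xpos u 0 = 0" using pv_xpos[OF assms(1) _ assms(2), of 0] by simp
  have "xpos u H = Re (pv u n)" using pv_xpos[OF assms(1) _ assms(2), of n] depth_n[OF assms(1)] by simp
  also have "\<dots> = (\<Sum>i=1..n. c (u i) * s (u i))" using Re_pv[OF assms(1)] by simp
  also have "\<dots> = (\<Sum>i=1..n. c i * s i)"
    using sum.permute[OF assms(1), of "\<lambda>i. c i * s i"] by (simp add: comp_def)
  finally show "xpos u H = (\<Sum>i=1..n. c i * s i)" .
qed

lemma continuous_xpos: "continuous_on UNIV (xpos u)"
  unfolding xpos_def by (intro continuous_intros)

text \<open>Only the vertex between the two exchanged edges moves, since the sum of their vectors is
  unchanged.\<close>

lemma pv_swap:
  assumes "l \<noteq> k" "k \<ge> 1"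
  shows "pv (swap_adj u k) l = pv u l" "depth (swap_adj u k) l = depth u l"
proof -
  have "pv (swap_adj u k) l = pv u l \<and> depth (swap_adj u k) l = depth u l"
    if "l < k" for l using that
  proof (induction l)
    case (Suc l)
    then show ?case by (simp add: pv_Suc depth_Suc swap_adj_simps del: comp_apply cis.simps)
  qed simp
  note low = this
  have k: "pv (swap_adj u k) (Suc k) = pv u (Suc k) \<and> depth (swap_adj u k) (Suc k) = depth u (Suc k)"
    using low[of "k - 1"] assms(2)
      pv_pred[OF assms(2), of u] pv_pred[OF assms(2), of "swap_adj u k"]
      depth_pred[OF assms(2), of u] depth_pred[OF assms(2), of "swap_adj u k"]
    by (simp add: pv_Suc depth_Suc swap_adj_simps del: comp_apply cis.simps)
  have "pv (swap_adj u k) l = pv u l \<and> depth (swap_adj u k) l = depth u l" if "Suc k \<le> l" for l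
    using that
  proof (induction l rule: dec_induct)
    case base
    then show ?case using k .
  next
    case (step m)
    then show ?case by (simp add: pv_Suc depth_Suc swap_adj_simps del: comp_apply cis.simps)
  qed
  then show "pv (swap_adj u k) l = pv u l" "depth (swap_adj u k) l = depth u l"
    using low[of l] assms(1) by (metis Suc_leI linorder_neqE_nat)+
qed

lemma pe_swap:
  assumes "l \<noteq> k" "l \<noteq> Suc k" "k \<ge> 1" "l \<ge> 1"
  shows "pe (swap_adj u k) l = pe u l"
  unfolding path_edge_def using assms pv_swap(1)[of l k u] pv_swap(1)[of "l - 1" k u] by auto

section \<open>The rhombus swept by one exchange\<close>

definition flip_tile :: "(nat \<Rightarrow> nat) \<Rightarrow> nat \<Rightarrow> complex set" where
  "flip_tile u k = rhombus \<theta> (pv u (k - 1)) (u k) (u (Suc k))"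

context
  fixes u :: "nat \<Rightarrow> nat" and k :: nat
  assumes u: "u permutes {1..n}" and k: "1 \<le> k" "k < n" and asc: "u k < u (Suc k)"
begin

lemma flip_labels: "u k \<in> {1..n}" "u (Suc k) \<in> {1..n}"
  using permutes_label[OF u, of k] permutes_label[OF u, of "Suc k"] k by auto

text \<open>Above the tile both exchanged terms are clamped to 0, below it both are saturated;
  either way their order is invisible.\<close>

lemma xpos_swap_outside:
  assumes "t \<le> depth u (k - 1) \<or> depth u (Suc k) \<le> t"
  shows "xpos (swap_adj u k) t = xpos u t"
proof -
  let ?u' = "swap_adj u k"
  let ?f = "\<lambda>u l. c (u l) * max 0 (min (s (u l)) (t - depth u (l - 1)))"
  have split: "{1..n} = insert k (insert (Suc k) ({1..n} - {k, Suc k}))" using k by auto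
  have "(\<Sum>l\<in>{1..n} - {k, Suc k}. ?f ?u' l) = (\<Sum>l\<in>{1..n} - {k, Suc k}. ?f u l)"
  proof (rule sum.cong[OF refl])
    fix l assume l: "l \<in> {1..n} - {k, Suc k}"
    then have "l - 1 \<noteq> k" by auto
    then show "?f ?u' l = ?f u l"
      using l k pv_swap(2)[of "l - 1" k u] by (simp add: swap_adj_simps del: comp_apply)
  qed
  moreover have "?f ?u' k + ?f ?u' (Suc k) = ?f u k + ?f u (Suc k)"
  proof -
    have d: "depth ?u' (k - 1) = depth u (k - 1)" using pv_swap(2)[of "k - 1" k u] k by auto
    have d': "depth ?u' k = depth u (k - 1) + s (u (Suc k))"
      using depth_pred[of k ?u'] k d by (simp add: swap_adj_simps del: comp_apply)
    have e: "depth u k = depth u (k - 1) + s (u k)" using depth_pred k by blast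
    have e': "depth u (Suc k) = depth u k + s (u (Suc k))" by (simp add: depth_Suc)
    have p: "s (u k) > 0" "s (u (Suc k)) > 0" using flip_labels s_pos by auto
    have "?f ?u' k + ?f ?u' (Suc k) = c (u (Suc k)) * max 0 (min (s (u (Suc k))) (t - depth u (k - 1))) +
        c (u k) * max 0 (min (s (u k)) (t - (depth u (k - 1) + s (u (Suc k)))))"
      unfolding diff_Suc_1 d d' swap_adj_simps ..
    also have "\<dots> = ?f u k + ?f u (Suc k)"
      unfolding diff_Suc_1 e
    proof (cases "t \<le> depth u (k - 1)")
      case False
      then have "depth u (k - 1) + s (u k) + s (u (Suc k)) \<le> t" using assms e e' by linarith
      then show "c (u (Suc k)) * max 0 (min (s (u (Suc k))) (t - depth u (k - 1))) +
        c (u k) * max 0 (min (s (u k)) (t - (depth u (k - 1) + s (u (Suc k))))) =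
        c (u k) * max 0 (min (s (u k)) (t - depth u (k - 1))) +
        c (u (Suc k)) * max 0 (min (s (u (Suc k))) (t - (depth u (k - 1) + s (u k))))"
        using p by (simp add: min_absorb1)
    qed (use p in \<open>simp add: min_absorb2\<close>)
    finally show ?thesis .
  qed
  moreover have "sum g {1..n} = (g k + g (Suc k)) + sum g ({1..n} - {k, Suc k})" for g :: "nat \<Rightarrow> real"
    by (subst split) simp
  ultimately show ?thesis unfolding xpos_def by presburger
qed

text \<open>The strips give two lower and two upper bounds on the horizontal position. The path
  \<open>u\<close> is the larger lower bound and the exchanged path the smaller upper bound; they
  switch at the left and the right vertex, at relative depths \<open>s i\<close> and
  \<open>s j\<close>.\<close>

lemma flip_tile_iff:
  "z \<in> flip_tile u k \<longleftrightarrow> depth u (k - 1) \<le> - Im z \<and> - Im z \<le> depth u (Suc k) \<and>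
    xpos u (- Im z) \<le> Re z \<and> Re z \<le> xpos (swap_adj u k) (- Im z)"
proof -
  let ?u' = "swap_adj u k"
  define p i j where "p = pv u (k - 1)" and "i = u k" and "j = u (Suc k)"
  have u': "?u' permutes {1..n}" using permutes_swap u k by blast
  have ij: "i \<in> {1..n}" "j \<in> {1..n}" "i < j" using flip_labels asc by (auto simp: i_def j_def)
  have sp: "s i > 0" "s j > 0" "c i < c j" using s_pos c_less ij by auto
  have p': "pv ?u' (k - 1) = p" "depth ?u' (k - 1) = depth u (k - 1)" 
    using pv_swap[of "k - 1" k u] k by (auto simp: p_def)
  have dk: "depth u k = depth u (k - 1) + s i" using depth_pred[of k u] k by (simp add: i_def)
  have dk': "depth ?u' k = depth u (k - 1) + s j"
    using depth_pred[of k ?u'] k p' by (simp add: j_def swap_adj_simps del: comp_apply)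
  have dS: "depth u (Suc k) = depth u (k - 1) + s i + s j" using dk by (simp add: depth_Suc j_def)
  have dS': "depth ?u' (Suc k) = depth u (Suc k)" using pv_swap(2)[of "Suc k" k u] k by auto
  have pk: "Re (pv u k) = Re p + c i * s i" using pv_pred[of k u] k Re_v[OF ij(1)]
    by (simp add: p_def i_def del: cis.simps)
  have pk': "Re (pv ?u' k) = Re p + c j * s j" using pv_pred[of k ?u'] k Re_v[OF ij(2)] p'
    by (simp add: p_def j_def swap_adj_simps del: cis.simps comp_apply)
  define t where "t = - Im z - depth u (k - 1)"
  have xu1: "xpos u (- Im z) = Re p + c i * t" if "0 \<le> t" "t \<le> s i"
    using xpos_piece[OF u, of k "- Im z"] that k dk by (simp add: t_def i_def p_def)
  have xu2: "xpos u (- Im z) = Re p + c i * s i + c j * (t - s i)" if "s i \<le> t" "t \<le> s i + s j"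
    using xpos_piece[OF u, of "Suc k" "- Im z"] that k dk dS pk by (simp add: t_def j_def algebra_simps)
  have xw1: "xpos ?u' (- Im z) = Re p + c j * t" if "0 \<le> t" "t \<le> s j"
    using xpos_piece[OF u', of k "- Im z"] that k dk' p'
    by (simp add: t_def j_def swap_adj_simps del: comp_apply)
  have xw2: "xpos ?u' (- Im z) = Re p + c j * s j + c i * (t - s j)" if "s j \<le> t" "t \<le> s i + s j"
    using xpos_piece[OF u', of "Suc k" "- Im z"] that k dk' dS dS' pk'
    by (simp add: t_def i_def algebra_simps swap_adj_simps del: comp_apply)
  define x where "x = Re z - Re p"
  have oi: "off i (z - p) = x - c i * t" "off j (z - p) = x - c j * t"
    by (simp_all add: off_def x_def t_def p_def Im_pv algebra_simps)
  have R: "z \<in> flip_tile u k \<longleftrightarrow> c i * t \<le> x \<and> x \<le> c i * t + s j * (c j - c i) \<and>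
      x \<le> c j * t \<and> c j * t - s i * (c j - c i) \<le> x"
    unfolding flip_tile_def p_def[symmetric] i_def[symmetric] j_def[symmetric] rhombus_iff[OF ij] oi
    by auto
  have D: "depth u (k - 1) \<le> - Im z \<longleftrightarrow> 0 \<le> t" "- Im z \<le> depth u (Suc k) \<longleftrightarrow> t \<le> s i + s j"
    using dS by (auto simp: t_def)
  have m: "(c j - c i) * a \<le> (c j - c i) * b \<longleftrightarrow> a \<le> b" for a b
    using sp by (simp add: mult_le_cancel_left_pos)
  show ?thesis unfolding R D
  proof (cases "0 \<le> t \<and> t \<le> s i + s j")
    case False
    \<comment> \<open>Playing a lower against an upper bound on \<open>x\<close> recovers the depth
      range, which the strip inequalities do not mention.\<close>
    have "0 \<le> t" if "c i * t \<le> x" "x \<le> c j * t"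
      using m[of 0 t] that by (simp add: algebra_simps)
    moreover have "t \<le> s i + s j" if "c j * t - s i * (c j - c i) \<le> x" "x \<le> c i * t + s j * (c j - c i)"
      using m[of t "s i + s j"] that by (simp add: algebra_simps)
    ultimately show "(c i * t \<le> x \<and> x \<le> c i * t + s j * (c j - c i) \<and>
      x \<le> c j * t \<and> c j * t - s i * (c j - c i) \<le> x) \<longleftrightarrow> (0 \<le> t \<and> t \<le> s i + s j \<and>
      xpos u (- Im z) \<le> Re z \<and> Re z \<le> xpos (swap_adj u k) (- Im z))" using False by blast
  next
    case True
    have A: "xpos u (- Im z) \<le> Re z \<longleftrightarrow> c i * t \<le> x \<and> c j * t - s i * (c j - c i) \<le> x"
    proof (cases "t \<le> s i")
      case le: True
      then have "c j * t - s i * (c j - c i) \<le> c i * t" using m[of t "s i"] by (simp add: algebra_simps)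
      then show ?thesis using xu1 le True by (auto simp: x_def)
    next
      case False
      then have "c i * t \<le> c j * t - s i * (c j - c i)" using m[of "s i" t] by (simp add: algebra_simps)
      then show ?thesis using xu2 False True by (auto simp: x_def algebra_simps)
    qed
    have B: "Re z \<le> xpos ?u' (- Im z) \<longleftrightarrow> x \<le> c j * t \<and> x \<le> c i * t + s j * (c j - c i)"
    proof (cases "t \<le> s j")
      case le: True
      then have "c j * t \<le> c i * t + s j * (c j - c i)" using m[of t "s j"] by (simp add: algebra_simps)
      then show ?thesis using xw1 le True by (auto simp: x_def)
    next
      case False
      then have "c i * t + s j * (c j - c i) \<le> c j * t" using m[of "s j" t] by (simp add: algebra_simps)
      then show ?thesis using xw2 False True by (auto simp: x_def algebra_simps)
    qed
    show "(c i * t \<le> x \<and> x \<le> c i * t + s j * (c j - c i) \<and>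
      x \<le> c j * t \<and> c j * t - s i * (c j - c i) \<le> x) \<longleftrightarrow> (0 \<le> t \<and> t \<le> s i + s j \<and>
      xpos u (- Im z) \<le> Re z \<and> Re z \<le> xpos (swap_adj u k) (- Im z))"
      unfolding A B using True by auto
  qed
qed

lemma flip_tile_edges:
  "pe u k edge_of flip_tile u k" "pe u (Suc k) edge_of flip_tile u k"
  "pe (swap_adj u k) k edge_of flip_tile u k" "pe (swap_adj u k) (Suc k) edge_of flip_tile u k"
proof -
  have ij: "u k \<in> {1..n}" "u (Suc k) \<in> {1..n}" "u k < u (Suc k)" using flip_labels asc by auto
  have p': "pv (swap_adj u k) (k - 1) = pv u (k - 1)"
    using pv_swap(1)[of "k - 1" k u] k by auto
  have pk: "pv u k = pv u (k - 1) + v (u k)" using k pv_pred by blast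
  have pk': "pv (swap_adj u k) k = pv u (k - 1) + v (u (Suc k))"
    using k pv_pred[of k "swap_adj u k"] p' by (simp add: swap_adj_simps del: comp_apply cis.simps)
  note E = rhombus_edges[OF ij, of "pv u (k - 1)", folded flip_tile_def]
  show "pe u k edge_of flip_tile u k" using E(1) k by (simp add: pe_eq)
  show "pe u (Suc k) edge_of flip_tile u k" using E(2) k by (simp add: pe_eq pk)
  show "pe (swap_adj u k) k edge_of flip_tile u k" using E(3)
    unfolding pe_eq[OF k(1)] p' swap_adj_simps .
  show "pe (swap_adj u k) (Suc k) edge_of flip_tile u k" using E(4) k
    by (simp add: pe_eq pk' swap_adj_simps del: comp_apply cis.simps)
qed

end

lemma xpos_swap_le:
  assumes u: "u permutes {1..n}" and k: "1 \<le> k" "k < n" and asc: "u k < u (Suc k)"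
  shows "xpos u t \<le> xpos (swap_adj u k) t"
proof (cases "depth u (k - 1) \<le> t \<and> t \<le> depth u (Suc k)")
  case False
  then show ?thesis using xpos_swap_outside[OF assms, of t] by auto
next
  case True
  \<comment> \<open>The tile contains the point of the path at this depth, so its horizontal section is nonempty.\<close>
  note E = flip_tile_edges[OF assms]
  have Sk: "Suc k \<in> {1..n}" "k \<in> {1..n}" using k by auto
  define z where "z = Complex (xpos u t) (- t)"
  have "z \<in> pe u k \<or> z \<in> pe u (Suc k)"
    unfolding pe_iff[OF u Sk(1)] pe_iff[OF u Sk(2)] using True by (simp add: z_def) linarith
  then have "z \<in> flip_tile u k" using E(1,2) unfolding edge_of_def by (meson face_of_imp_subset subsetD)
  then show ?thesis unfolding flip_tile_iff[OF assms] by (simp add: z_def)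
qed

lemma xpos_id_le:
  assumes "u permutes {1..n}"
  shows "xpos id t \<le> xpos u t"
  using assms
proof (induction rule: permutes_ascent_induct)
  case (swap u k)
  then show ?case using xpos_swap_le[of u k t] by linarith
qed simp

section \<open>The polygon as the region between two graphs\<close>

definition region :: "(nat \<Rightarrow> nat) \<Rightarrow> complex set" where
  "region u = {z. 0 \<le> - Im z \<and> - Im z \<le> H \<and> xpos id (- Im z) \<le> Re z \<and> Re z \<le> xpos u (- Im z)}"

lemma permutes_id_nat: "(id :: nat \<Rightarrow> nat) permutes {1..n}" by (rule permutes_id)

text \<open>At the depths of the tile two horizontal intervals abut at the path \<open>u\<close>; at
  all other depths the two paths agree.\<close>

lemma region_swap:
  assumes u: "u permutes {1..n}" and k: "1 \<le> k" "k < n" and asc: "u k < u (Suc k)"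
  shows "region (swap_adj u k) = region u \<union> flip_tile u k"
proof (intro set_eqI)
  fix z
  have L: "xpos id (- Im z) \<le> xpos u (- Im z)" by (rule xpos_id_le[OF u])
  have L': "xpos u (- Im z) \<le> xpos (swap_adj u k) (- Im z)" by (rule xpos_swap_le[OF assms])
  have d: "0 \<le> depth u (k - 1)" "depth u (Suc k) \<le> H"
    using depth_bounds[OF u, of "k - 1"] depth_bounds[OF u, of "Suc k"] k by auto
  show "z \<in> region (swap_adj u k) \<longleftrightarrow> z \<in> region u \<union> flip_tile u k"
  proof (cases "depth u (k - 1) \<le> - Im z \<and> - Im z \<le> depth u (Suc k)")
    case True
    then have t: "0 \<le> - Im z" "- Im z \<le> H" using d by linarith+
    have "z \<in> region u' \<longleftrightarrow> xpos id (- Im z) \<le> Re z \<and> Re z \<le> xpos u' (- Im z)" for u'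
      using t by (simp add: region_def)
    moreover have "z \<in> flip_tile u k \<longleftrightarrow> xpos u (- Im z) \<le> Re z \<and> Re z \<le> xpos (swap_adj u k) (- Im z)"
      using True unfolding flip_tile_iff[OF assms] by simp
    ultimately show ?thesis unfolding Un_iff using L L' by (meson linear order_trans)
  next
    case False
    then have "xpos (swap_adj u k) (- Im z) = xpos u (- Im z)"
      by (intro xpos_swap_outside[OF assms]) (simp add: not_le, linarith)
    moreover have "z \<notin> flip_tile u k" using False unfolding flip_tile_iff[OF assms] by blast
    ultimately show ?thesis unfolding region_def by simp
  qed
qed

lemma region_id: "n \<ge> 1 \<Longrightarrow> region id = (\<Union>k\<in>{1..n}. pe id k)"
  unfolding set_eq_iff path_iff[OF permutes_id_nat] region_def by auto

lemma sides_iff: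
  assumes "w permutes {1..n}" "n \<ge> 1"
  shows "z \<in> \<Union> (elnitsky_sides n \<theta> w) \<longleftrightarrow>
    0 \<le> - Im z \<and> - Im z \<le> H \<and> (Re z = xpos id (- Im z) \<or> Re z = xpos w (- Im z))"
  unfolding elnitsky_sides_def Union_Un_distrib Un_iff path_iff[OF assms]
    path_iff[OF permutes_id_nat assms(2)] by auto

lemma not_bounded_horizontal_ray:
  assumes "\<bar>d\<bar> = 1"
  shows "\<not> bounded {z + complex_of_real (d * r) |r. 0 \<le> r}"
proof
  assume "bounded {z + complex_of_real (d * r) |r. 0 \<le> r}"
  then obtain B where B: "\<And>x. x \<in> {z + complex_of_real (d * r) |r. 0 \<le> r} \<Longrightarrow> norm x \<le> B"
    unfolding bounded_iff by blast
  define r where "r = \<bar>B\<bar> + norm z + 1"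
  have "0 \<le> r" unfolding r_def by simp
  then have "norm (z + complex_of_real (d * r)) \<le> B" by (intro B) blast
  moreover have "r = norm (complex_of_real (d * r))"
    using assms \<open>0 \<le> r\<close> by (simp add: norm_mult)
  moreover have "norm (complex_of_real (d * r)) \<le> norm (z + complex_of_real (d * r)) + norm z"
    by (metis add.commute norm_add_leD order_refl)
  ultimately show False using r_def by linarith
qed

lemma horizontal_ray_outside:
  assumes "\<bar>d\<bar> = 1" and "\<And>r. 0 \<le> r \<Longrightarrow> z + complex_of_real (d * r) \<notin> C"
  shows "z \<notin> inside C"
proof
  assume "z \<in> inside C"
  then have b: "bounded (connected_component_set (- C) z)" unfolding inside_def by blast
  let ?R = "(\<lambda>r. z + complex_of_real (d * r)) ` {0..}"
  have "connected ?R"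
    by (intro connected_continuous_image continuous_intros) auto
  moreover have "z \<in> ?R" by (rule image_eqI[of _ _ 0]) auto
  moreover have "?R \<subseteq> - C" using assms(2) by auto
  ultimately have "?R \<subseteq> connected_component_set (- C) z"
    by (intro connected_component_maximal)
  then have "bounded ?R" using b bounded_subset by blast
  moreover have "?R = {z + complex_of_real (d * r) |r. 0 \<le> r}" by auto
  ultimately show False using not_bounded_horizontal_ray[OF assms(1)] by simp
qed

text \<open>A component of the complement of the boundary \<open>C\<close> that meets the open set
  \<open>D\<close> cannot cross the frontier of \<open>D\<close>, which lies in \<open>C\<close>; so
  it stays in the bounded set \<open>D\<close>. Points off the region escape along a horizontal
  ray.\<close>

lemma elnitsky_polygon_eq_region:
  assumes w: "w permutes {1..n}" and n: "n \<ge> 1"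
  shows "elnitsky_polygon n \<theta> w = region w"
proof -
  define C where "C = \<Union> (elnitsky_sides n \<theta> w)"
  note C = sides_iff[OF w n, folded C_def]
  define D where "D = {z. 0 < - Im z \<and> - Im z < H \<and> xpos id (- Im z) < Re z \<and> Re z < xpos w (- Im z)}"
  note LR = xpos_id_le[OF w]
  have cont: "continuous_on UNIV (\<lambda>z. xpos u (- Im z))" for u
    by (rule continuous_on_compose2[OF continuous_xpos]) (auto intro!: continuous_intros)
  have ends: "xpos w 0 = xpos id 0" "xpos w H = xpos id H"
    using xpos_ends[OF w n] xpos_ends[OF permutes_id_nat n] by auto
  have "open D"
    unfolding D_def by (intro open_Collect_conj open_Collect_less continuous_intros cont)
  have clR: "closed (region w)"
    unfolding region_def by (intro closed_Collect_conj closed_Collect_le continuous_intros cont)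
  have DR: "D \<subseteq> region w" unfolding D_def region_def by auto
  have RDC: "region w = D \<union> C"
  proof (intro set_eqI)
    fix z
    show "z \<in> region w \<longleftrightarrow> z \<in> D \<union> C"
    proof (cases "- Im z = 0 \<or> - Im z = H")
      case True
      \<comment> \<open>At the top and bottom depth the two paths meet, so the region has a single
        point there, and it lies on \<open>C\<close>.\<close>
      then have "xpos w (- Im z) = xpos id (- Im z)" using ends by metis
      then show ?thesis unfolding region_def D_def Un_iff C by auto
    next
      case False
      then show ?thesis using LR[of "- Im z"] unfolding region_def D_def Un_iff C by auto
    qed
  qed
  have Dd: "D \<inter> C = {}" unfolding D_def using C by auto
  have "bounded D"
  proof -
    have bd: "bounded ((\<lambda>t. xpos u t) ` {0..H})" for u
      by (intro compact_imp_bounded compact_continuous_image continuous_on_subset[OF continuous_xpos]) auto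
    obtain a where "\<forall>x\<in>xpos id ` {0..H}. norm x \<le> a" using bd[of id] unfolding bounded_iff by blast
    then have a: "\<bar>xpos id t\<bar> \<le> a" if "t \<in> {0..H}" for t using that by auto
    obtain b where "\<forall>x\<in>xpos w ` {0..H}. norm x \<le> b" using bd[of w] unfolding bounded_iff by blast
    then have b: "\<bar>xpos w t\<bar> \<le> b" if "t \<in> {0..H}" for t using that by auto
    have "norm z \<le> (\<bar>a\<bar> + \<bar>b\<bar>) + H" if "z \<in> D" for z
    proof -
      have "\<bar>Re z\<bar> \<le> \<bar>a\<bar> + \<bar>b\<bar>" "\<bar>Im z\<bar> \<le> H"
        using that a[of "- Im z"] b[of "- Im z"] unfolding D_def by auto
      then show ?thesis using cmod_le[of z] by linarith
    qed
    then show ?thesis unfolding bounded_iff by blast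
  qed
  have "closure D \<subseteq> D \<union> C" using closure_minimal[OF DR clR] unfolding RDC .
  then have "frontier D \<subseteq> C" unfolding frontier_def interior_open[OF \<open>open D\<close>] by auto
  have inD: "z \<in> inside C" if "z \<in> D" for z
  proof -
    let ?K = "connected_component_set (- C) z"
    have zK: "z \<in> ?K" using that Dd by (auto intro: connected_component_refl)
    have "?K \<subseteq> D"
    proof (rule ccontr)
      assume "\<not> ?K \<subseteq> D"
      moreover have "?K \<inter> D \<noteq> {}" using zK that by blast
      ultimately have "?K \<inter> frontier D \<noteq> {}"
        by (intro connected_Int_frontier connected_connected_component) auto
      moreover have "?K \<subseteq> - C" by (rule connected_component_subset)
      ultimately show False using \<open>frontier D \<subseteq> C\<close> by blast
    qed
    then have "bounded ?K" using \<open>bounded D\<close> bounded_subset by blast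
    then show ?thesis unfolding inside_def using that Dd by blast
  qed
  have "z \<notin> inside C" if out: "z \<notin> region w" for z
  proof -
    consider "- Im z < 0 \<or> - Im z > H" | "0 \<le> - Im z" "- Im z \<le> H" "Re z < xpos id (- Im z)"
      | "0 \<le> - Im z" "- Im z \<le> H" "Re z > xpos w (- Im z)"
      using out unfolding region_def mem_Collect_eq not_le[symmetric] by blast
    then show ?thesis
    proof cases
      case 1
      show ?thesis by (rule horizontal_ray_outside[of 1]) (use 1 in \<open>auto simp: C\<close>)
    next
      case 2
      then show ?thesis using LR[of "- Im z"]
        by (intro horizontal_ray_outside[of "- 1"]) (auto simp: C)
    next
      case 3
      then show ?thesis using LR[of "- Im z"]
        by (intro horizontal_ray_outside[of 1]) (auto simp: C)
    qed
  qed
  moreover have "inside C \<inter> C = {}" by (simp add: inside_no_overlap)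
  ultimately have "inside C = D" using inD RDC by blast
  then show ?thesis unfolding elnitsky_polygon_def C_def[symmetric] using RDC by blast
qed

lemma off_inj:
  assumes "i \<in> {1..n}" "j \<in> {1..n}" "i \<noteq> j" "off i x = off i y" "off j x = off j y"
  shows "x = y"
proof -
  have "(c i - c j) * (Im x - Im y) = 0" using assms(4,5) by (simp add: off_def algebra_simps)
  then have "Im x = Im y" using c_eq_iff[OF assms(1,2)] assms(3) by simp
  then show ?thesis using assms(4) by (simp add: off_def complex_eq_iff)
qed

lemma off_pe:
  assumes "u permutes {1..n}" "l \<in> {1..n}" "z \<in> pe u l"
  shows "off (u l) z = off (u l) (pv u (l - 1))"
  using assms(3) pe_eq[of l u] assms(2) segment_iff[OF permutes_label[OF assms(1,2)]] by auto

lemma not_side_both: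
  assumes w: "w permutes {1..n}" and fs: "fully_supported n w" and n: "n \<ge> 2" and k: "k \<in> {1..n}"
  shows "pe w k \<notin> pe id ` {1..n}"
proof
  assume "pe w k \<in> pe id ` {1..n}"
  then obtain j where j: "j \<in> {1..n}" and eq: "pe w k = pe id j" by auto
  define p q m where "p = pv w (k - 1)" and "q = pv id (j - 1)" and "m = w k"
  have m: "m \<in> {1..n}" using permutes_label[OF w k] by (simp add: m_def)
  have "closed_segment p (p + v m) = closed_segment q (q + v j)"
    using eq j k by (simp add: pe_eq p_def q_def m_def)
  from segment_eqD[OF m j this] have pq: "p = q" and mj: "m = j" .
  define A where "A = w ` {1..k - 1}"
  define L where "L = {1..j - 1}"
  have inj: "inj_on w B" for B using permutes_inj[OF w] by (meson inj_on_subset subset_UNIV)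
  have An: "A \<subseteq> {1..n}" unfolding A_def using permutes_label[OF w] k by force
  have Ln: "L \<subseteq> {1..n}" unfolding L_def using j by auto
  have jA: "j \<notin> A"
  proof
    assume "j \<in> A"
    then obtain i where "i \<in> {1..k - 1}" "w i = w k" unfolding A_def using mj m_def by auto
    then show False using injD[OF permutes_inj[OF w]] by fastforce
  qed
  have sums: "(\<Sum>a\<in>A. v a) = (\<Sum>a\<in>L. v a)"
    using pq unfolding p_def q_def path_vertex_def A_def L_def by (simp add: sum.reindex[OF inj])
  define f where "f a = s a * (c a - c j)" for a
  have offsum: "off j (\<Sum>a\<in>B. v a) = (\<Sum>a\<in>B. f a)" if "B \<subseteq> {1..n}" for B
  proof -
    have "finite B" using that finite_subset by blast
    then show ?thesis using that
    proof (induction B)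
      case (insert x B)
      then show ?case using off_v[of x j] by (simp add: f_def del: cis.simps)
    qed simp
  qed
  have fin: "finite A" "finite L" using An Ln finite_subset by blast+
  have "sum f A = sum f L" using arg_cong[OF sums, of "off j"] offsum An Ln by simp
  then have e: "sum f (A - L) = sum f (L - A)"
    using sum.Int_Diff[OF fin(1), of f L] sum.Int_Diff[OF fin(2), of f A] by (simp add: Int_commute)
  have pos: "f a > 0" if "a \<in> A - L" for a
  proof -
    have a: "a \<in> {1..n}" "a \<noteq> j" "a \<notin> L" using that An jA by blast+
    then have "j < a" unfolding L_def by simp
    with a show ?thesis using off_gap[OF j] by (simp add: f_def)
  qed
  have neg: "f a < 0" if "a \<in> L - A" for a
  proof -
    have a: "a \<in> {1..n}" using that Ln by blast
    have "a < j" using that j unfolding L_def by auto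
    with a show ?thesis using s_pos[of a] c_less[of a j] j by (simp add: f_def mult_pos_neg)
  qed
  have "A - L = {}"
  proof (rule ccontr)
    assume "A - L \<noteq> {}"
    then have "sum f (A - L) > 0" using fin pos by (intro sum_pos) auto
    moreover have "sum f (L - A) \<le> 0" using neg by (intro sum_nonpos) (auto intro: less_imp_le)
    ultimately show False using e by simp
  qed
  moreover have "L - A = {}"
  proof (rule ccontr)
    assume "L - A \<noteq> {}"
    then have "sum (\<lambda>a. - f a) (L - A) > 0" using fin neg by (intro sum_pos) auto
    moreover have "sum f (A - L) \<ge> 0" using pos by (intro sum_nonneg) (auto intro: less_imp_le)
    ultimately show False using e by (simp add: sum_negf)
  qed
  ultimately have AL: "A = L" by blast
  have "card A = k - 1" unfolding A_def by (simp add: card_image[OF inj])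
  then have kj: "k = j" using AL j k unfolding L_def by auto
  show False
  \<comment> \<open>For \<open>k = 1\<close> the common prefix is empty and says nothing; the prefix
    of length 1 is used instead, as \<open>w 1 = 1\<close>.\<close>
  proof (cases "k = 1")
    case True
    then have "w ` {1..1} = {1..1}" using mj kj m_def by simp
    then show False using fs n unfolding fully_supported_def by (metis le_refl Suc_1 Suc_le_eq One_nat_def)
  next
    case False
    then have "1 \<le> k - 1" "k - 1 < n" "w ` {1..k - 1} = {1..k - 1}"
      using AL kj k unfolding A_def L_def by auto
    then show False using fs unfolding fully_supported_def by blast
  qed
qed

section \<open>Tilings from sequences of exchanges\<close>

text \<open>Invariant of the construction. The left boundary is added to the union because no tile
  covers it where \<open>u\<close> still follows it. Tiles must meet the edges of the current path
  in faces, so that the next tile fits edge-to-edge. The last two clauses track uncovered edges: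
  they lie on both paths.\<close>

definition partial_tiling :: "(nat \<Rightarrow> nat) \<Rightarrow> complex set set \<Rightarrow> bool" where
  "partial_tiling u T \<longleftrightarrow> u permutes {1..n} \<and> finite T \<and>
    (\<forall>S\<in>T. \<exists>i j. tile_with_labels n \<theta> S i j) \<and>
    \<Union> T \<union> (\<Union>k\<in>{1..n}. pe id k) = region u \<and>
    pairwise (\<lambda>A B. interior A \<inter> interior B = {}) T \<and>
    pairwise (\<lambda>A B. (A \<inter> B) face_of A \<and> (A \<inter> B) face_of B) T \<and>
    (\<forall>A\<in>T. \<forall>l\<in>{1..n}. (A \<inter> pe u l) face_of A \<and> (A \<inter> pe u l) face_of pe u l) \<and>
    (\<forall>l\<in>{1..n}. (\<exists>S\<in>T. pe u l edge_of S) \<or> pe u l \<in> pe id ` {1..n}) \<and>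
    (\<forall>l\<in>{1..n}. (\<exists>S\<in>T. pe id l edge_of S) \<or> pe id l \<in> pe u ` {1..n})"

lemma partial_tiling_id: "n \<ge> 1 \<Longrightarrow> partial_tiling id {}"
  unfolding partial_tiling_def using permutes_id_nat region_id by auto

lemma tile_convex_closed:
  assumes "tile_with_labels n \<theta> S i j"
  shows "convex S" "closed S"
  using assms convex_rhombus closed_rhombus unfolding tile_with_labels_def by blast+

lemma convex_pe: "convex (pe u l)" by (simp add: path_edge_def)

lemma interior_shift_right:
  assumes "z \<in> interior A"
  obtains e where "e > 0" "z + complex_of_real e \<in> A"
proof -
  obtain d where d: "d > 0" "cball z d \<subseteq> A" using assms mem_interior_cball by blast
  have "z + complex_of_real d \<in> cball z d" using d(1) by (simp add: dist_norm)
  then show ?thesis using that d by blast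
qed

context
  fixes u :: "nat \<Rightarrow> nat" and k :: nat
  assumes u: "u permutes {1..n}" and k: "1 \<le> k" "k < n" and asc: "u k < u (Suc k)"
begin

lemma flip_ends:
  shows "pv (swap_adj u k) (k - 1) = pv u (k - 1)"
    and "pv u k = pv u (k - 1) + v (u k)"
    and "pv u (Suc k) = pv u (k - 1) + v (u k) + v (u (Suc k))"
    and "pv (swap_adj u k) k = pv u (k - 1) + v (u (Suc k))"
proof -
  show 1: "pv (swap_adj u k) (k - 1) = pv u (k - 1)"
    using pv_swap(1)[of "k - 1" k u] k by auto
  show 2: "pv u k = pv u (k - 1) + v (u k)" using k pv_pred by blast
  then show "pv u (Suc k) = pv u (k - 1) + v (u k) + v (u (Suc k))" using pv_Suc by metis
  show "pv (swap_adj u k) k = pv u (k - 1) + v (u (Suc k))"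
    using pv_pred[OF k(1), of "swap_adj u k"] unfolding 1 swap_adj_simps .
qed

lemma flip_pe_segments:
  shows "pe u k = closed_segment (pv u (k - 1)) (pv u k)"
    and "pe u (Suc k) = closed_segment (pv u k) (pv u (Suc k))"
    and "pe (swap_adj u k) k = closed_segment (pv u (k - 1)) (pv (swap_adj u k) k)"
    and "pe (swap_adj u k) (Suc k) = closed_segment (pv (swap_adj u k) k) (pv u (Suc k))"
  unfolding path_edge_def using flip_ends(1) pv_swap(1)[of "Suc k" k u] k by simp_all

text \<open>Old tiles lie to the left of the path and the new one to its right, so they can meet
  only on the path.\<close>

lemma flip_tile_inter_left:
  assumes "A \<subseteq> region u"
  shows "A \<inter> flip_tile u k = (A \<inter> pe u k) \<union> (A \<inter> pe u (Suc k))"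
proof -
  have K: "k \<in> {1..n}" "Suc k \<in> {1..n}" using k by auto
  have "z \<in> pe u k \<union> pe u (Suc k)" if "z \<in> A" "z \<in> flip_tile u k" for z
  proof -
    have "Re z \<le> xpos u (- Im z)" using that(1) assms unfolding region_def by auto
    then have "Re z = xpos u (- Im z)" "depth u (k - 1) \<le> - Im z" "- Im z \<le> depth u (Suc k)"
      using that(2) unfolding flip_tile_iff[OF u k asc] by auto
    then show ?thesis unfolding Un_iff pe_iff[OF u K(1)] pe_iff[OF u K(2)] diff_Suc_1 by linarith
  qed
  moreover have "pe u k \<subseteq> flip_tile u k" "pe u (Suc k) \<subseteq> flip_tile u k"
    using flip_tile_edges[OF u k asc] by (auto simp: edge_of_def dest: face_of_imp_subset)
  ultimately show ?thesis by blast
qed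

text \<open>The lines that carry the four sides of the new tile; the last two facts separate the
  parallel ones.\<close>

lemma flip_off:
  shows "z \<in> pe u k \<Longrightarrow> off (u k) z = off (u k) (pv u k)"
    and "z \<in> pe u k \<Longrightarrow> off (u k) z = off (u k) (pv u (k - 1))"
    and "z \<in> pe u (Suc k) \<Longrightarrow> off (u (Suc k)) z = off (u (Suc k)) (pv u k)"
    and "z \<in> pe u (Suc k) \<Longrightarrow> off (u (Suc k)) z = off (u (Suc k)) (pv u (Suc k))"
    and "z \<in> pe (swap_adj u k) k \<Longrightarrow> off (u (Suc k)) z = off (u (Suc k)) (pv u (k - 1))"
    and "z \<in> pe (swap_adj u k) (Suc k) \<Longrightarrow> off (u k) z = off (u k) (pv u (Suc k))"
    and "off (u k) (pv u (Suc k)) \<noteq> off (u k) (pv u (k - 1))"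
    and "off (u (Suc k)) (pv u k) \<noteq> off (u (Suc k)) (pv u (k - 1))"
proof -
  note ij = flip_labels[OF u k asc]
  have K: "k \<in> {1..n}" "Suc k \<in> {1..n}" using k by auto
  have u': "swap_adj u k permutes {1..n}" using permutes_swap[OF u k] .
  show a: "z \<in> pe u k \<Longrightarrow> off (u k) z = off (u k) (pv u (k - 1))" using off_pe[OF u K(1)] .
  show "z \<in> pe u k \<Longrightarrow> off (u k) z = off (u k) (pv u k)"
    using a unfolding flip_ends(2) using off_v_self[OF ij(1)] by simp
  show b: "z \<in> pe u (Suc k) \<Longrightarrow> off (u (Suc k)) z = off (u (Suc k)) (pv u k)"
    using off_pe[OF u K(2)] unfolding diff_Suc_1 .
  show "z \<in> pe u (Suc k) \<Longrightarrow> off (u (Suc k)) z = off (u (Suc k)) (pv u (Suc k))"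
    using b unfolding pv_Suc using off_v_self[OF ij(2)] by simp
  show "z \<in> pe (swap_adj u k) k \<Longrightarrow> off (u (Suc k)) z = off (u (Suc k)) (pv u (k - 1))"
    using off_pe[OF u' K(1)] unfolding swap_adj_simps flip_ends(1) .
  show "z \<in> pe (swap_adj u k) (Suc k) \<Longrightarrow> off (u k) z = off (u k) (pv u (Suc k))"
    using off_pe[OF u' K(2)] unfolding swap_adj_simps diff_Suc_1 flip_ends(3,4) using off_v_self[OF ij(1)] by simp
  have gap: "s (u k) * (c (u (Suc k)) - c (u k)) \<noteq> 0" "s (u (Suc k)) * (c (u (Suc k)) - c (u k)) \<noteq> 0"
    using off_gap[OF ij asc] by linarith+
  show "off (u k) (pv u (Suc k)) \<noteq> off (u k) (pv u (k - 1))"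
    unfolding flip_ends(3) off_simps off_v[OF ij(2)] off_v_self[OF ij(1)] using gap by simp
  show "off (u (Suc k)) (pv u k) \<noteq> off (u (Suc k)) (pv u (k - 1))"
    unfolding flip_ends(2) off_simps off_v[OF ij(1)] using gap by simp
qed

lemma off_midpoint: "off i (midpoint a b) = (off i a + off i b) / 2"
  by (simp add: midpoint_def)

text \<open>The intersection is a union of two faces, and one must contain the other: for points
  \<open>a\<close> and \<open>b\<close> in one edge only, the midpoint would lie on an edge too,
  forcing \<open>a\<close> or \<open>b\<close> to be the common vertex
  \<open>pv u k\<close>.\<close>

lemma flip_tile_face:
  assumes A: "convex A" "A \<subseteq> region u"
    and f: "(A \<inter> pe u k) face_of A" "(A \<inter> pe u k) face_of pe u k"
      "(A \<inter> pe u (Suc k)) face_of A" "(A \<inter> pe u (Suc k)) face_of pe u (Suc k)"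
  shows "(A \<inter> flip_tile u k) face_of A \<and> (A \<inter> flip_tile u k) face_of flip_tile u k"
proof -
  note E = flip_tile_edges[OF u k asc, unfolded edge_of_def]
  let ?F = "A \<inter> pe u k" and ?G = "A \<inter> pe u (Suc k)"
  have ij: "u k \<in> {1..n}" "u (Suc k) \<in> {1..n}" "u k \<noteq> u (Suc k)" using flip_labels[OF u k asc] asc by auto
  have m: "pv u k \<in> pe u k" "pv u k \<in> pe u (Suc k)" unfolding flip_pe_segments by simp_all
  have "?F \<subseteq> ?G \<or> ?G \<subseteq> ?F"
  proof (rule ccontr)
    assume "\<not> (?F \<subseteq> ?G \<or> ?G \<subseteq> ?F)"
    then obtain a b where a: "a \<in> A" "a \<in> pe u k" "a \<notin> pe u (Suc k)"
      and b: "b \<in> A" "b \<in> pe u (Suc k)" "b \<notin> pe u k" by blast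
    have ne: "a \<noteq> pv u k" "b \<noteq> pv u k" using a b m by auto
    have "midpoint a b \<in> A" using A(1) a(1) b(1) by (meson convex_contains_segment midpoint_in_closed_segment subsetD)
    moreover have "midpoint a b \<in> flip_tile u k"
    proof -
      have "a \<in> flip_tile u k" "b \<in> flip_tile u k"
        using a b flip_tile_inter_left[OF A(2)] by blast+
      then show ?thesis unfolding flip_tile_def
        by (meson convex_rhombus convex_contains_segment midpoint_in_closed_segment subsetD)
    qed
    ultimately have "midpoint a b \<in> pe u k \<or> midpoint a b \<in> pe u (Suc k)"
      using flip_tile_inter_left[OF A(2)] by blast
    then show False
    proof
      assume "midpoint a b \<in> pe u k"
      from flip_off(1)[OF this] flip_off(1)[OF a(2)] have "off (u k) b = off (u k) (pv u k)"
        by (simp add: off_midpoint)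
      from off_inj[OF ij this flip_off(3)[OF b(2)]] show False using ne by simp
    next
      assume "midpoint a b \<in> pe u (Suc k)"
      from flip_off(3)[OF this] flip_off(3)[OF b(2)] have "off (u (Suc k)) a = off (u (Suc k)) (pv u k)"
        by (simp add: off_midpoint)
      from off_inj[OF ij flip_off(1)[OF a(2)] this] show False using ne by simp
    qed
  qed
  then have "A \<inter> flip_tile u k = ?F \<or> A \<inter> flip_tile u k = ?G"
    unfolding flip_tile_inter_left[OF A(2)] by blast
  moreover have "?F face_of flip_tile u k" "?G face_of flip_tile u k"
    using f E face_of_trans by blast+
  ultimately show ?thesis using f(1,3) by metis
qed

text \<open>An interior point of \<open>A\<close> can be moved to the right within \<open>A\<close>,
  but a point of the new tile is already at or beyond the right end of
  \<open>region u\<close>.\<close>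

lemma flip_tile_interior:
  assumes "A \<subseteq> region u"
  shows "interior A \<inter> interior (flip_tile u k) = {}"
proof (rule ccontr)
  assume "interior A \<inter> interior (flip_tile u k) \<noteq> {}"
  then obtain z where z: "z \<in> interior A" "z \<in> flip_tile u k" using interior_subset by blast
  obtain e where e: "e > 0" "z + complex_of_real e \<in> A" using interior_shift_right[OF z(1)] .
  then have "z + complex_of_real e \<in> region u" using assms by blast
  then show False using z(2) e(1) unfolding region_def flip_tile_iff[OF u k asc] by simp
qed

text \<open>An old tile reaches a new edge only at the end that this edge shares with the old
  path.\<close>

lemma flip_old_tile_new_edges:
  assumes A: "A \<subseteq> region u"
    and f: "(A \<inter> pe u k) face_of A" "(A \<inter> pe u (Suc k)) face_of A"
  shows "(A \<inter> pe (swap_adj u k) k) face_of A \<and> (A \<inter> pe (swap_adj u k) k) face_of pe (swap_adj u k) k"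
    and "(A \<inter> pe (swap_adj u k) (Suc k)) face_of A \<and>
      (A \<inter> pe (swap_adj u k) (Suc k)) face_of pe (swap_adj u k) (Suc k)"
proof -
  let ?u' = "swap_adj u k"
  note E = flip_tile_edges[OF u k asc, unfolded edge_of_def]
  have ij: "u k \<in> {1..n}" "u (Suc k) \<in> {1..n}" "u k \<noteq> u (Suc k)" using flip_labels[OF u k asc] asc by auto
  have sub: "pe ?u' k \<subseteq> flip_tile u k" "pe ?u' (Suc k) \<subseteq> flip_tile u k"
    using E by (auto dest: face_of_imp_subset)
  \<comment> \<open>The point \<open>q\<close> is a vertex of the old edge \<open>e\<close>, hence a
    face of \<open>F \<inter> e\<close> and, by transitivity, of \<open>F\<close>.\<close>
  have single: "F \<inter> G face_of F \<and> F \<inter> G face_of G"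
    if "F \<inter> G \<subseteq> {q}" "(F \<inter> e) face_of F" "{q} face_of e" "q \<in> e" "{q} face_of G" for F G e :: "complex set" and q
  proof (cases "F \<inter> G = {}")
    case False
    then have q: "F \<inter> G = {q}" "q \<in> F" using that(1) by blast+
    have "{q} face_of (F \<inter> e)" by (rule face_of_subset[OF that(3)]) (use q that in auto)
    then show ?thesis using q that face_of_trans by metis
  qed simp
  have "a = pv u (k - 1)" if a: "a \<in> A" "a \<in> pe ?u' k" for a
  proof -
    have "a \<in> pe u k \<or> a \<in> pe u (Suc k)" using flip_tile_inter_left[OF A] a sub by blast
    then show ?thesis
    proof
      assume "a \<in> pe u k"
      from off_inj[OF ij flip_off(2)[OF this] flip_off(5)[OF a(2)]] show ?thesis .
    next
      assume "a \<in> pe u (Suc k)"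
      from flip_off(3)[OF this] flip_off(5)[OF a(2)] flip_off(8) show ?thesis by simp
    qed
  qed
  then have "A \<inter> pe ?u' k \<subseteq> {pv u (k - 1)}" by blast
  then show "(A \<inter> pe ?u' k) face_of A \<and> (A \<inter> pe ?u' k) face_of pe ?u' k"
    by (rule single[OF _ f(1)]) (simp_all add: flip_pe_segments endpoint_face_of_segment)
  have "a = pv u (Suc k)" if a: "a \<in> A" "a \<in> pe ?u' (Suc k)" for a
  proof -
    have "a \<in> pe u k \<or> a \<in> pe u (Suc k)" using flip_tile_inter_left[OF A] a sub by blast
    then show ?thesis
    proof
      assume "a \<in> pe u (Suc k)"
      from off_inj[OF ij flip_off(6)[OF a(2)] flip_off(4)[OF this]] show ?thesis .
    next
      assume "a \<in> pe u k"
      from flip_off(2)[OF this] flip_off(6)[OF a(2)] flip_off(7) show ?thesis by simp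
    qed
  qed
  then have "A \<inter> pe ?u' (Suc k) \<subseteq> {pv u (Suc k)}" by blast
  then show "(A \<inter> pe ?u' (Suc k)) face_of A \<and> (A \<inter> pe ?u' (Suc k)) face_of pe ?u' (Suc k)"
    by (rule single[OF _ f(2)]) (simp_all add: flip_pe_segments endpoint_face_of_segment)
qed

text \<open>The two new path edges are edges of the tile. The remaining ones end no lower than its
  top or start no higher than its bottom, and so touch it at most in a vertex.\<close>

lemma flip_new_tile_edges:
  assumes l: "l \<in> {1..n}"
  shows "(flip_tile u k \<inter> pe (swap_adj u k) l) face_of flip_tile u k \<and>
    (flip_tile u k \<inter> pe (swap_adj u k) l) face_of pe (swap_adj u k) l"
proof -
  let ?u' = "swap_adj u k" and ?B = "flip_tile u k"
  note E = flip_tile_edges[OF u k asc, unfolded edge_of_def]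
  have ij: "u k \<in> {1..n}" "u (Suc k) \<in> {1..n}" "u k < u (Suc k)" using flip_labels[OF u k asc] asc by auto
  have cB: "convex ?B" unfolding flip_tile_def by (rule convex_rhombus)
  have n1: "n \<ge> 1" using k by simp
  consider "l = k \<or> l = Suc k" | "l < k" | "l > Suc k" by linarith
  then show ?thesis
  proof cases
    case 1
    then have "pe ?u' l face_of ?B" using E by auto
    moreover then have "?B \<inter> pe ?u' l = pe ?u' l" using face_of_imp_subset by blast
    ultimately show ?thesis using face_of_refl[OF convex_pe] by metis
  next
    case 2
    have e: "pe ?u' l = pe u l" using 2 l k by (intro pe_swap) auto
    have le: "depth u l \<le> depth u (k - 1)" using 2 k by (intro depth_mono[OF u]) auto
    have "(pe u l \<inter> ?B) face_of pe u l \<and> (pe u l \<inter> ?B) face_of ?B"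
    proof (rule face_of_touching_heights[OF convex_pe cB, of u l "Im (pv u (k - 1))" "pv u (k - 1)"])
      fix z assume z: "z \<in> pe u l"
      then show "Im z \<ge> Im (pv u (k - 1))" using le unfolding Im_pv pe_iff[OF u l] by linarith
      assume "Im z = Im (pv u (k - 1))"
      then show "z = pv u (k - 1)"
        using z pv_xpos[OF u _ n1, of "k - 1"] k unfolding pe_iff[OF u l] by (simp add: complex_eq_iff Im_pv)
    next
      fix z assume "z \<in> ?B"
      note h = rhombus_Im[OF ij this[unfolded flip_tile_def]]
      show "Im z \<le> Im (pv u (k - 1))" by (rule h(2))
      show "z = pv u (k - 1)" if "Im z = Im (pv u (k - 1))" by (rule h(3)[OF that])
    qed
    then show ?thesis unfolding e by (simp add: Int_commute)
  next
    case 3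
    have e: "pe ?u' l = pe u l" using 3 l k by (intro pe_swap) auto
    have le: "depth u (Suc k) \<le> depth u (l - 1)" using 3 l by (intro depth_mono[OF u]) auto
    have q: "Im (pv u (Suc k)) = Im (pv u (k - 1)) - s (u k) - s (u (Suc k))"
      unfolding flip_ends(3) by (simp add: Im_v del: cis.simps)
    have "(?B \<inter> pe u l) face_of ?B \<and> (?B \<inter> pe u l) face_of pe u l"
    proof (rule face_of_touching_heights[OF cB convex_pe, of "Im (pv u (Suc k))" u l "pv u (Suc k)"])
      fix z assume z: "z \<in> pe u l"
      then show "Im z \<le> Im (pv u (Suc k))" using le unfolding Im_pv pe_iff[OF u l] by linarith
      assume "Im z = Im (pv u (Suc k))"
      then show "z = pv u (Suc k)"
        using z pv_xpos[OF u _ n1, of "Suc k"] k unfolding pe_iff[OF u l]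
        by (simp add: complex_eq_iff Im_pv)
    next
      fix z assume "z \<in> ?B"
      note h = rhombus_Im[OF ij this[unfolded flip_tile_def]]
      show "Im z \<ge> Im (pv u (Suc k))" unfolding q by (rule h(1))
      show "z = pv u (Suc k)" if "Im z = Im (pv u (Suc k))"
        unfolding flip_ends(3) by (rule h(4)) (use that q in simp)
    qed
    then show ?thesis unfolding e .
  qed
qed

end

lemma partial_tiling_flip:
  assumes pt: "partial_tiling u T" and k: "1 \<le> k" "k < n" and asc: "u k < u (Suc k)"
  shows "partial_tiling (swap_adj u k) (insert (flip_tile u k) T)"
proof -
  let ?u' = "swap_adj u k" and ?B = "flip_tile u k"
  have u: "u permutes {1..n}" and fin: "finite T"
    and lab: "\<And>S. S \<in> T \<Longrightarrow> \<exists>i j. tile_with_labels n \<theta> S i j"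
    and un: "\<Union> T \<union> (\<Union>k\<in>{1..n}. pe id k) = region u"
    and int: "pairwise (\<lambda>A B. interior A \<inter> interior B = {}) T"
    and fac: "pairwise (\<lambda>A B. (A \<inter> B) face_of A \<and> (A \<inter> B) face_of B) T"
    and edg: "\<And>A l. A \<in> T \<Longrightarrow> l \<in> {1..n} \<Longrightarrow> (A \<inter> pe u l) face_of A \<and> (A \<inter> pe u l) face_of pe u l"
    and up: "\<And>l. l \<in> {1..n} \<Longrightarrow> (\<exists>S\<in>T. pe u l edge_of S) \<or> pe u l \<in> pe id ` {1..n}"
    and lp: "\<And>l. l \<in> {1..n} \<Longrightarrow> (\<exists>S\<in>T. pe id l edge_of S) \<or> pe id l \<in> pe u ` {1..n}"
    using pt unfolding partial_tiling_def by blast+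
  note ctx = u k asc
  note E = flip_tile_edges[OF ctx]
  have K: "k \<in> {1..n}" "Suc k \<in> {1..n}" using k by auto
  have sub: "A \<subseteq> region u" "convex A" if "A \<in> T" for A
    using un lab[OF that] tile_convex_closed that by blast+
  have F: "(A \<inter> ?B) face_of A \<and> (A \<inter> ?B) face_of ?B" if "A \<in> T" for A
    using flip_tile_face[OF ctx sub(2,1)[OF that]] edg[OF that K(1)] edg[OF that K(2)] by blast
  have I: "interior A \<inter> interior ?B = {}" if "A \<in> T" for A
    using flip_tile_interior[OF ctx sub(1)[OF that]] .
  have oth: "pe ?u' l = pe u l" if "l \<in> {1..n}" "l \<noteq> k" "l \<noteq> Suc k" for l
    using that k by (intro pe_swap) auto
  have 1: "?u' permutes {1..n}" using permutes_swap[OF u k] .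
  have 2: "tile_with_labels n \<theta> ?B (u k) (u (Suc k))"
    using flip_labels[OF u k asc] asc unfolding tile_with_labels_def flip_tile_def by auto
  have 3: "\<Union> (insert ?B T) \<union> (\<Union>k\<in>{1..n}. pe id k) = region ?u'"
    unfolding region_swap[OF ctx] un[symmetric] by blast
  have 4: "pairwise (\<lambda>A B. interior A \<inter> interior B = {}) (insert ?B T)"
    unfolding pairwise_insert using int I by (auto simp: Int_commute)
  have 5: "pairwise (\<lambda>A B. (A \<inter> B) face_of A \<and> (A \<inter> B) face_of B) (insert ?B T)"
    unfolding pairwise_insert using fac F by (metis Int_commute)
  have 6: "(A \<inter> pe ?u' l) face_of A \<and> (A \<inter> pe ?u' l) face_of pe ?u' l"
    if A: "A \<in> insert ?B T" and l: "l \<in> {1..n}" for A l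
  proof (cases "A = ?B")
    case True
    then show ?thesis using flip_new_tile_edges[OF ctx l] by simp
  next
    case False
    then have AT: "A \<in> T" using A by blast
    have f: "(A \<inter> pe u k) face_of A" "(A \<inter> pe u (Suc k)) face_of A"
      using edg[OF AT K(1)] edg[OF AT K(2)] by auto
    consider "l = k" | "l = Suc k" | "l \<noteq> k" "l \<noteq> Suc k" by blast
    then show ?thesis
    proof cases
      case 3
      then show ?thesis using edg[OF AT l] oth[OF l] by metis
    qed (use flip_old_tile_new_edges[OF ctx sub(1)[OF AT] f] in blast)+
  qed
  have 7: "(\<exists>S\<in>insert ?B T. pe ?u' l edge_of S) \<or> pe ?u' l \<in> pe id ` {1..n}" if "l \<in> {1..n}" for l
  proof (cases "l = k \<or> l = Suc k")
    case True
    then show ?thesis using E by blast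
  next
    case False
    then show ?thesis using up[OF that] oth[OF that] by auto
  qed
  have 8: "(\<exists>S\<in>insert ?B T. pe id l edge_of S) \<or> pe id l \<in> pe ?u' ` {1..n}" if l: "l \<in> {1..n}" for l
  proof (cases "\<exists>S\<in>T. pe id l edge_of S")
    case False
    then obtain i where i: "i \<in> {1..n}" "pe id l = pe u i" using lp[OF l] by auto
    show ?thesis
    proof (cases "i = k \<or> i = Suc k")
      case True
      then show ?thesis using E i by auto
    next
      case False
      then show ?thesis using oth[OF i(1)] i by (metis image_eqI)
    qed
  qed blast
  show ?thesis
    unfolding partial_tiling_def
    by (intro conjI ballI 1 3 4 5 7 8 6[THEN conjunct1] 6[THEN conjunct2]) (use fin lab 2 in auto)
qed

text \<open>A relation, because the tiles depend on the order of the exchanges and not only on the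
  path reached; the choice among them is what refutes forcedness.\<close>

inductive flips :: "(nat \<Rightarrow> nat) \<Rightarrow> complex set set \<Rightarrow> bool" where
  flips_id: "flips id {}"
| flips_swap: "flips u T \<Longrightarrow> u permutes {1..n} \<Longrightarrow> 1 \<le> k \<Longrightarrow> k < n \<Longrightarrow> u k < u (Suc k) \<Longrightarrow>
    flips (swap_adj u k) (insert (flip_tile u k) T)"

lemma flips_partial_tiling: "flips u T \<Longrightarrow> n \<ge> 1 \<Longrightarrow> partial_tiling u T"
  by (induction rule: flips.induct) (auto intro: partial_tiling_id partial_tiling_flip)

text \<open>Full support removes the alternative of an edge on both boundaries, so every side is an
  edge of a tile; in particular the tiles alone cover the left boundary.\<close>

lemma flips_rhombic_tiling:
  assumes "flips w T" and n: "n \<ge> 2" and w: "w permutes {1..n}" and fs: "fully_supported n w"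
  shows "T \<in> rhombic_tilings n \<theta> w"
proof -
  have n1: "n \<ge> 1" using n by simp
  have fin: "finite T"
    and lab: "\<forall>S\<in>T. \<exists>i j. tile_with_labels n \<theta> S i j"
    and un: "\<Union> T \<union> (\<Union>k\<in>{1..n}. pe id k) = region w"
    and int: "pairwise (\<lambda>A B. interior A \<inter> interior B = {}) T"
    and fac: "pairwise (\<lambda>A B. (A \<inter> B) face_of A \<and> (A \<inter> B) face_of B) T"
    and up: "\<And>l. l \<in> {1..n} \<Longrightarrow> (\<exists>S\<in>T. pe w l edge_of S) \<or> pe w l \<in> pe id ` {1..n}"
    and lp: "\<And>l. l \<in> {1..n} \<Longrightarrow> (\<exists>S\<in>T. pe id l edge_of S) \<or> pe id l \<in> pe w ` {1..n}"
    using flips_partial_tiling[OF assms(1) n1] unfolding partial_tiling_def by blast+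
  have R: "\<exists>S\<in>T. pe w l edge_of S" if "l \<in> {1..n}" for l
    using up[OF that] not_side_both[OF w fs n that] by blast
  have L: "\<exists>S\<in>T. pe id l edge_of S" if l: "l \<in> {1..n}" for l
  proof (rule ccontr)
    assume "\<not> (\<exists>S\<in>T. pe id l edge_of S)"
    then obtain i where "i \<in> {1..n}" "pe id l = pe w i" using lp[OF l] by auto
    then show False using not_side_both[OF w fs n, of i] l by (metis image_eqI)
  qed
  have "pe id l \<subseteq> \<Union> T" if "l \<in> {1..n}" for l
    using L[OF that] unfolding edge_of_def by (meson Sup_upper face_of_imp_subset order_trans)
  then have "\<Union> T = elnitsky_polygon n \<theta> w"
    unfolding elnitsky_polygon_eq_region[OF w n1] un[symmetric] by blast
  then show ?thesis
    unfolding rhombic_tilings_def elnitsky_sides_def using fin lab int fac L R by blast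
qed

lemma flips_exists:
  assumes "u permutes {1..n}"
  shows "\<exists>T. flips u T"
  using assms by (induction rule: permutes_ascent_induct) (blast intro: flips.intros)+

text \<open>The tile is created when \<open>1\<close> leaves the first position and \<open>y\<close>
  replaces it. Later exchanges at the front can only increase the first label.\<close>

lemma flips_first_label:
  assumes "flips u T"
  shows "u 1 = 1 \<or> (\<exists>y. 1 < y \<and> y \<le> u 1 \<and> rhombus \<theta> 0 1 y \<in> T)"
  using assms
proof (induction rule: flips.induct)
  case (flips_swap u T k)
  show ?case
  proof (cases "k = 1")
    case True
    have new: "swap_adj u k 1 = u 2" "u 1 < u 2"
      using flips_swap.hyps(5) True by (simp_all add: Transposition.transpose_def numeral_2_eq_2)
    show ?thesis
    proof (cases "u 1 = 1")
      case u1: True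
      have "flip_tile u k = rhombus \<theta> 0 1 (u 2)"
        unfolding flip_tile_def True using u1 by (simp add: numeral_2_eq_2)
      then show ?thesis using new u1 by (metis insertI1 le_refl)
    next
      case False
      then obtain y where "1 < y" "y \<le> u 1" "rhombus \<theta> 0 1 y \<in> T" using flips_swap.IH by blast
      then show ?thesis using new by (metis insertI2 less_imp_le order_trans)
    qed
  next
    case False
    then have "swap_adj u k 1 = u 1" using flips_swap.hyps(3) by (intro swap_adj_simps) auto
    then show ?thesis using flips_swap.IH by auto
  qed
qed simp

text \<open>A left-to-right minimum can be carried back to the front by undoing descents. The
  sequence through that earlier path already has its tile at the first left edge, bounded by this
  label, and keeps it.\<close>

lemma flips_through_front:
  assumes "1 \<le> k" "k \<le> n" "u permutes {1..n}" "u k \<noteq> 1"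
    and "\<And>j. 1 \<le> j \<Longrightarrow> j < k \<Longrightarrow> u k < u j"
  shows "\<exists>T y. flips u T \<and> 1 < y \<and> y \<le> u k \<and> rhombus \<theta> 0 1 y \<in> T"
  using assms
proof (induction k arbitrary: u rule: dec_induct)
  case base
  then show ?case using flips_exists[OF base(2)] flips_first_label by blast
next
  case (step k)
  define u0 where "u0 = swap_adj u k"
  have k: "1 \<le> k" "k < n" using step by auto
  have u0: "u0 permutes {1..n}" unfolding u0_def using permutes_swap[OF step(5) k] .
  have v: "u0 k = u (Suc k)" "u0 (Suc k) = u k" unfolding u0_def by (rule swap_adj_simps)+
  have "u0 k < u0 j" if "1 \<le> j" "j < k" for j
  proof -
    have "u0 j = u j" unfolding u0_def using that by (intro swap_adj_simps) auto
    then show ?thesis using step(7)[of j] that v by simp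
  qed
  then obtain T y where T: "flips u0 T" "1 < y" "y \<le> u0 k" "rhombus \<theta> 0 1 y \<in> T"
    using step.IH[of u0] u0 k v step(6) by auto
  have "u0 k < u0 (Suc k)" using step(7)[of k] k v by simp
  from flips_swap[OF T(1) u0 k this] have "flips (swap_adj u0 k) (insert (flip_tile u0 k) T)" .
  moreover have "swap_adj u0 k = u" unfolding u0_def by (simp add: comp_assoc)
  ultimately show ?case using T v by (metis insertI2)
qed

section \<open>Sweeping a tiling\<close>

lemma tile_rhombus:
  assumes "tile_with_labels n \<theta> S x y"
  obtains p i j where "i \<in> {1..n}" "j \<in> {1..n}" "i < j" "{i, j} = {x, y}" "S = rhombus \<theta> p i j"
proof -
  obtain p where xy: "x \<in> {1..n}" "y \<in> {1..n}" "x \<noteq> y" "S = rhombus \<theta> p x y"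
    using assms unfolding tile_with_labels_def by blast
  show ?thesis
  proof (cases "x < y")
    case True
    show ?thesis by (rule that[OF xy(1,2) True refl xy(4)])
  next
    case False
    then have "y < x" using xy(3) by simp
    show ?thesis
      by (rule that[OF xy(2,1) \<open>y < x\<close> insert_commute xy(4)[unfolded rhombus_commute[of p x y]]])
  qed
qed

lemma rel_interior_segment:
  "m \<in> {1..n} \<Longrightarrow> rel_interior (closed_segment a (a + v m)) = open_segment a (a + v m)"
  by (simp add: rel_interior_closed_segment)

context
  fixes w :: "nat \<Rightarrow> nat" and T :: "complex set set"
  assumes n: "n \<ge> 2" and w: "w permutes {1..n}" and T: "T \<in> rhombic_tilings n \<theta> w"
begin

lemma tiling:
  shows "finite T" and "S \<in> T \<Longrightarrow> \<exists>i j. tile_with_labels n \<theta> S i j"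
    and "\<Union> T = region w"
    and "A \<in> T \<Longrightarrow> B \<in> T \<Longrightarrow> interior A \<inter> interior B \<noteq> {} \<Longrightarrow> A = B"
    and "A \<in> T \<Longrightarrow> B \<in> T \<Longrightarrow> (A \<inter> B) face_of A \<and> (A \<inter> B) face_of B"
    and "l \<in> {1..n} \<Longrightarrow> \<exists>S\<in>T. pe id l edge_of S"
    and "l \<in> {1..n} \<Longrightarrow> \<exists>S\<in>T. pe w l edge_of S"
proof -
  have n1: "n \<ge> 1" using n by simp
  note * = T[unfolded rhombic_tilings_def elnitsky_sides_def mem_Collect_eq elnitsky_polygon_eq_region[OF w n1]]
  have int: "pairwise (\<lambda>A B. interior A \<inter> interior B = {}) T" using * by (elim conjE)
  have fac: "pairwise (\<lambda>A B. (A \<inter> B) face_of A \<and> (A \<inter> B) face_of B) T" using * by (elim conjE)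
  have sides: "\<forall>e\<in>pe id ` {1..n} \<union> pe w ` {1..n}. \<exists>S\<in>T. e edge_of S" using * by (elim conjE)
  show "finite T" using * by (elim conjE)
  show "\<Union> T = region w" using * by (elim conjE)
  have "\<forall>S\<in>T. \<exists>i j. tile_with_labels n \<theta> S i j" using * by (elim conjE)
  then show lab: "\<exists>i j. tile_with_labels n \<theta> S i j" if "S \<in> T" for S using that by (rule bspec)
  show "A = B" if "A \<in> T" "B \<in> T" "interior A \<inter> interior B \<noteq> {}"
    using pairwiseD[OF int that(1,2)] that(3) by metis
  show "(A \<inter> B) face_of A \<and> (A \<inter> B) face_of B" if "A \<in> T" "B \<in> T"
  proof (cases "A = B")
    case True
    then show ?thesis using lab[OF that(1)] tile_convex_closed(1) face_of_refl by auto
  next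
    case False
    then show ?thesis using pairwiseD[OF fac that] by simp
  qed
  show "\<exists>S\<in>T. pe id l edge_of S" "\<exists>S\<in>T. pe w l edge_of S" if "l \<in> {1..n}"
    by (rule bspec[OF sides], use that in simp)+
qed

text \<open>The face \<open>S \<inter> S'\<close> of \<open>S\<close> contains a relative interior
  point of \<open>e\<close>, hence all of \<open>e\<close>; thus \<open>e\<close> is a face of
  \<open>S \<inter> S'\<close>, which is a face of \<open>S'\<close>.\<close>

lemma face_extend:
  assumes "S \<in> T" "S' \<in> T" "e face_of S" "q \<in> rel_interior e" "q \<in> S'"
  shows "e face_of S'"
proof -
  have K: "(S \<inter> S') face_of S" "(S \<inter> S') face_of S'" using tiling(5)[OF assms(1,2)] by auto
  have eS: "e \<subseteq> S" using assms(3) by (rule face_of_imp_subset)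
  have "q \<in> S" using eS assms(4) rel_interior_subset by blast
  then have "e \<subseteq> S \<inter> S'" by (intro subset_of_face_of[OF K(1) eS]) (use assms in blast)
  then have "e face_of (S \<inter> S')" using face_of_subset[OF assms(3)] by blast
  then show ?thesis using K(2) by (rule face_of_trans)
qed

lemma edge_meets_right_side:
  assumes m: "m \<in> {1..n}" and S: "S \<in> T" and e: "closed_segment a (a + v m) edge_of S"
    and l: "l \<in> {1..n}" and q: "q \<in> open_segment a (a + v m)" "q \<in> pe w l"
  shows "closed_segment a (a + v m) = pe w l"
proof -
  let ?e = "closed_segment a (a + v m)"
  obtain S' where S': "S' \<in> T" "pe w l edge_of S'" using tiling(7)[OF l] by blast
  have eS: "?e face_of S" and fS: "pe w l face_of S'" using e S' by (auto simp: edge_of_def)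
  have wl: "w l \<in> {1..n}" using permutes_label[OF w l] .
  define b where "b = pv w (l - 1)"
  have f: "pe w l = closed_segment b (b + v (w l))" using pe_eq[of l w] l by (simp add: b_def)
  have "q \<in> ?e" using q(1) by (rule open_closed_segment)
  then have qS: "q \<in> S" using eS face_of_imp_subset by blast
  \<comment> \<open>The face of the side with \<open>q\<close> in its relative interior: the side
    itself or an endpoint. It passes to \<open>S\<close>, and faces of \<open>S\<close> with a
    common relative interior point coincide.\<close>
  obtain F where F: "F face_of pe w l" "q \<in> rel_interior F" "F = pe w l \<or> F = {q}"
  proof (cases "q \<in> open_segment b (b + v (w l))")
    case True
    show ?thesis
      by (rule that[of "pe w l"]) (use True f rel_interior_segment[OF wl] in \<open>auto intro: face_of_refl convex_pe\<close>)
  next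
    case False
    then have "q = b \<or> q = b + v (w l)" using q(2) unfolding f open_segment_def by auto
    then have "{q} face_of pe w l" unfolding f using endpoint_face_of_segment by metis
    then show ?thesis by (intro that[of "{q}"]) auto
  qed
  have "F face_of S" using face_extend[OF S'(1) S face_of_trans[OF F(1) fS] F(2) qS] .
  then have "F = ?e"
    by (rule face_of_eq[OF _ eS]) (use F(2) q(1) rel_interior_segment[OF m] in auto)
  moreover have "?e \<noteq> {q}" by (metis closed_segment_eq_sing add_cancel_right_right cis_neq_zero ends_in_segment singletonD)
  ultimately show ?thesis using F(3) by metis
qed

text \<open>A tile containing a point just to the right of the midpoint \<open>q\<close> also
  contains \<open>q\<close>, hence has the edge as its own edge. In case \<open>down\<close> this is
  the upper left side of the tile, in case \<open>up\<close> the lower left one.\<close>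

lemma right_tile:
  assumes m: "m \<in> {1..n}" and S: "S \<in> T" and e: "closed_segment a (a + v m) edge_of S"
    and nr: "closed_segment a (a + v m) \<notin> pe w ` {1..n}"
  obtains (down) y where "y \<in> {1..n}" "m < y" "rhombus \<theta> a m y \<in> T"
    | (up) y where "y \<in> {1..n}" "y < m" "rhombus \<theta> (a - v y) y m \<in> T"
proof -
  let ?e = "closed_segment a (a + v m)"
  have n1: "n \<ge> 1" using n by simp
  define q where "q = midpoint a (a + v m)"
  have qo: "q \<in> open_segment a (a + v m)" unfolding q_def by simp
  have qe: "q \<in> ?e" unfolding q_def by simp
  have ef: "?e face_of S" using e by (simp add: edge_of_def)
  have "q \<in> region w" using qe ef S tiling(3) face_of_imp_subset by blast
  then have qr: "0 \<le> - Im q" "- Im q \<le> H" "xpos id (- Im q) \<le> Re q" "Re q \<le> xpos w (- Im q)"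
    unfolding region_def by auto
  have "Re q \<noteq> xpos w (- Im q)"
  proof
    assume "Re q = xpos w (- Im q)"
    then have "q \<in> (\<Union>k\<in>{1..n}. pe w k)" unfolding path_iff[OF w n1] using qr by simp
    then obtain l where "l \<in> {1..n}" "q \<in> pe w l" by blast
    then show False using edge_meets_right_side[OF m S e _ qo] nr by blast
  qed
  then have dpos: "xpos w (- Im q) - Re q > 0" using qr by simp
  \<comment> \<open>There are finitely many closed tiles, so a small ball around \<open>q\<close>
    meets only those that contain \<open>q\<close>.\<close>
  have "closed (\<Union>{S \<in> T. q \<notin> S})"
    using tiling(1,2) tile_convex_closed(2) by (intro closed_Union) auto
  then have "open (- \<Union>{S \<in> T. q \<notin> S})" by (simp add: open_Compl)
  then obtain r where r: "r > 0" "ball q r \<subseteq> - \<Union>{S \<in> T. q \<notin> S}"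
    using open_contains_ball by (metis (no_types, lifting) ComplI UnionE mem_Collect_eq)
  define \<epsilon> where "\<epsilon> = min (r / 2) (xpos w (- Im q) - Re q)"
  have eps: "\<epsilon> > 0" "\<epsilon> < r" "\<epsilon> \<le> xpos w (- Im q) - Re q" using r(1) dpos by (auto simp: \<epsilon>_def)
  have "q + complex_of_real \<epsilon> \<in> region w" using qr eps unfolding region_def by simp
  then obtain S' where S': "S' \<in> T" "q + complex_of_real \<epsilon> \<in> S'" using tiling(3) by blast
  have "q + complex_of_real \<epsilon> \<in> ball q r" using eps by (simp add: dist_norm)
  then have qS': "q \<in> S'" using r(2) S' by blast
  have "?e face_of S'" 
    by (rule face_extend[OF S S'(1) ef _ qS']) (use qo rel_interior_segment[OF m] in simp)
  then have eS': "?e edge_of S'" using e by (simp add: edge_of_def)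
  obtain x y where "tile_with_labels n \<theta> S' x y" using tiling(2)[OF S'(1)] by blast
  then obtain p i j where ij: "i \<in> {1..n}" "j \<in> {1..n}" "i < j" and Sr: "S' = rhombus \<theta> p i j"
    by (rule tile_rhombus) blast
  have qa: "q = a + (1/2) *\<^sub>R v m" unfolding q_def midpoint_def by (simp add: scaleR_conv_of_real)
  have mem: "off i (q + complex_of_real \<epsilon> - p) \<le> s j * (c j - c i)" "off j (q + complex_of_real \<epsilon> - p) \<le> 0"
    using S'(2) unfolding Sr rhombus_iff[OF ij] by auto
  \<comment> \<open>If the edge were a right side of \<open>S'\<close>, the shift by
    \<open>\<epsilon>\<close> would leave one of the two strips.\<close>
  from rhombus_edge_cases[OF ij m eS'[unfolded Sr]]
  consider "m = i" "a = p" | "m = i" "a = p + v j" | "m = j" "a = p" | "m = j" "a = p + v i" by blast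
  then show thesis
  proof cases
    case 1
    then show ?thesis using down[OF ij(2)] ij S'(1) Sr by simp
  next
    case 2
    then have "off i (q + complex_of_real \<epsilon> - p) = s j * (c j - c i) + \<epsilon>"
      unfolding qa using off_v[OF ij(2), of i] off_v_self[OF ij(1)] by simp
    then show ?thesis using mem eps by simp
  next
    case 3
    then have "off j (q + complex_of_real \<epsilon> - p) = \<epsilon>"
      unfolding qa using off_v_self[OF ij(2)] by simp
    then show ?thesis using mem eps by simp
  next
    case 4
    then have "rhombus \<theta> (a - v i) i m \<in> T" using S'(1) Sr by simp
    then show ?thesis using up[OF ij(1)] 4 ij(3) by blast
  qed
qed

lemma tile_left_vertex_off_right_path:
  assumes "i \<in> {1..n}" "j \<in> {1..n}" "i < j" "rhombus \<theta> p i j \<in> T"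
  shows "Re (p + v i) < xpos w (- Im (p + v i))"
proof -
  obtain d where d: "d > 0" "\<And>e. 0 < e \<Longrightarrow> e < d \<Longrightarrow> p + v i + complex_of_real e \<in> interior (rhombus \<theta> p i j)"
    using left_vertex_interior[OF assms(1-3)] by meson
  have "p + v i + complex_of_real (d / 2) \<in> rhombus \<theta> p i j"
    using d(1) d(2)[of "d / 2"] interior_subset by auto
  then have "p + v i + complex_of_real (d / 2) \<in> region w" using assms(4) tiling(3) by blast
  then show ?thesis using d(1) unfolding region_def by simp
qed

text \<open>Both tiles fill a short piece to the right of the vertex, so their interiors meet and
  they coincide.\<close>

lemma tiles_common_left_vertex:
  assumes "i \<in> {1..n}" "j \<in> {1..n}" "i < j" "rhombus \<theta> p i j \<in> T"
    and "k \<in> {1..n}" "l \<in> {1..n}" "k < l" "rhombus \<theta> q k l \<in> T" and "p + v i = q + v k"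
  shows "p = q" "i = k" "j = l"
proof -
  have eq: "rhombus \<theta> p i j = rhombus \<theta> q k l"
    using tiling(4)[OF assms(4,8) rhombi_common_left_vertex[OF assms(1-3,5-7,9)]] .
  note D = rhombus_eqD[OF assms(1-3,5-7) eq]
  show "p = q" using D(1) .
  show ik: "i = k" using D(1) assms(9) v_eq_iff[OF assms(1,5)] by simp
  show "j = l" using D ik v_eq_iff[OF assms(2,6)] by simp
qed

text \<open>Depth increases strictly along \<open>w\<close>, so the right side starting at
  \<open>pv w l\<close> can only be the one with index \<open>Suc l\<close>.\<close>

lemma path_of_right_sides:
  assumes u: "u permutes {1..n}" and all: "\<And>l. l \<in> {1..n} \<Longrightarrow> pe u l \<in> pe w ` {1..n}"
  shows "u = w"
proof -
  have "pv u l = pv w l \<and> (\<forall>i\<in>{1..l}. u i = w i)" if "l \<le> n" for l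
    using that
  proof (induction l)
    case (Suc l)
    then have IH: "pv u l = pv w l" "\<forall>i\<in>{1..l}. u i = w i" by auto
    have l: "Suc l \<in> {1..n}" using Suc by auto
    then obtain j where j: "j \<in> {1..n}" "pe u (Suc l) = pe w j" using all by blast
    have "closed_segment (pv u l) (pv u l + v (u (Suc l))) =
      closed_segment (pv w (j - 1)) (pv w (j - 1) + v (w j))"
      using j pe_eq[of "Suc l" u] pe_eq[of j w] by auto
    from segment_eqD[OF permutes_label[OF u l] permutes_label[OF w j(1)] this]
    have e: "pv w l = pv w (j - 1)" "u (Suc l) = w j" using IH by auto
    then have "depth w l = depth w (j - 1)" using Im_pv[of w l] Im_pv[of w "j - 1"] by simp
    moreover have "l \<le> n" "j - 1 \<le> n" using l j(1) by auto
    ultimately have "l = j - 1"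
      using depth_less[OF w, of l "j - 1"] depth_less[OF w, of "j - 1" l]
      by (cases l "j - 1" rule: linorder_cases) auto
    then have "u (Suc l) = w (Suc l)" using e j(1) by simp
    then show ?case using IH by (auto simp: pv_Suc le_Suc_eq)
  qed simp
  then have "u i = w i" if "i \<in> {1..n}" for i using that by blast
  moreover have "u i = w i" if "i \<notin> {1..n}" for i
    using that permutes_not_in[OF u that] permutes_not_in[OF w that] by simp
  ultimately show ?thesis by blast
qed

lemma sweep_step:
  assumes u: "u permutes {1..n}" and ed: "\<And>l. l \<in> {1..n} \<Longrightarrow> \<exists>S\<in>T. pe u l edge_of S"
    and uw: "u \<noteq> w"
  shows "\<exists>k. 1 \<le> k \<and> k < n \<and> u k < u (Suc k) \<and> flip_tile u k \<in> T"
proof (rule ccontr)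
  assume none: "\<not> ?thesis"
  have n1: "n \<ge> 1" using n by simp
  define R where "R = pe w ` {1..n}"
  define a where "a = (LEAST l. l \<in> {1..n} \<and> pe u l \<notin> R)"
  have ex: "\<exists>l. l \<in> {1..n} \<and> pe u l \<notin> R" using path_of_right_sides[OF u] uw unfolding R_def by blast
  have a: "a \<in> {1..n}" "pe u a \<notin> R" using LeastI_ex[OF ex] unfolding a_def by auto
  have before: "pe u l \<in> R" if "1 \<le> l" "l < a" for l
    using not_less_Least[OF that(2)[unfolded a_def]] that a(1) by auto
  have onw: "Re z = xpos w (- Im z)" if "z \<in> pe u l" "pe u l \<in> R" for z l
    using that pe_iff[OF w] unfolding R_def by auto
  have tile: "(\<exists>y\<in>{1..n}. u l < y \<and> rhombus \<theta> (pv u (l - 1)) (u l) y \<in> T) \<or>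
      (\<exists>y\<in>{1..n}. y < u l \<and> rhombus \<theta> (pv u (l - 1) - v y) y (u l) \<in> T)"
    if l: "l \<in> {1..n}" "pe u l \<notin> R" for l
  proof -
    obtain S where S: "S \<in> T" "pe u l edge_of S" using ed[OF l(1)] by blast
    have e: "pe u l = closed_segment (pv u (l - 1)) (pv u (l - 1) + v (u l))" using pe_eq l(1) by simp
    show ?thesis
      by (rule right_tile[OF permutes_label[OF u l(1)] S(1) S(2)[unfolded e] l(2)[unfolded e R_def]]) blast+
  qed
  \<comment> \<open>To the right of the path, each edge from the \<open>a\<close>th on carries a tile hanging down from it: a
    tile standing up from the next edge would have the same left vertex and thus be the same tile.\<close>
  have main: "pe u k \<notin> R \<and> (\<exists>y\<in>{1..n}. u k < y \<and> rhombus \<theta> (pv u (k - 1)) (u k) y \<in> T)"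
    if "a \<le> k" "k \<le> n" for k
    using that
  proof (induction k rule: dec_induct)
    case base
    \<comment> \<open>The top of the first edge off the right boundary still lies on that boundary.
      A tile standing up from the edge would have this point as its left vertex, with no room to its
      right.\<close>
    have pa: "Re (pv u (a - 1)) = xpos w (- Im (pv u (a - 1)))"
    proof (cases "a = 1")
      case True
      then show ?thesis using xpos_ends(1)[OF w n1] by simp
    next
      case False
      then have "pe u (a - 1) \<in> R" "pv u (a - 1) \<in> pe u (a - 1)"
        using before[of "a - 1"] a(1) by (auto simp: path_edge_def)
      then show ?thesis using onw by blast
    qed
    have "\<not> (\<exists>y\<in>{1..n}. y < u a \<and> rhombus \<theta> (pv u (a - 1) - v y) y (u a) \<in> T)"
    proof
      assume "\<exists>y\<in>{1..n}. y < u a \<and> rhombus \<theta> (pv u (a - 1) - v y) y (u a) \<in> T"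
      then obtain y where y: "y \<in> {1..n}" "y < u a" "rhombus \<theta> (pv u (a - 1) - v y) y (u a) \<in> T" by blast
      from tile_left_vertex_off_right_path[OF y(1) permutes_label[OF u a(1)] y(2,3)] pa
      show False by (simp del: cis.simps)
    qed
    then show ?case using tile[OF a] a(2) by blast
  next
    case (step k)
    then obtain y where y: "y \<in> {1..n}" "u k < y" "rhombus \<theta> (pv u (k - 1)) (u k) y \<in> T" by auto
    have k: "k \<in> {1..n}" "Suc k \<in> {1..n}" "1 \<le> k" "k < n" using step a(1) by auto
    note uk = permutes_label[OF u k(1)] and uk' = permutes_label[OF u k(2)]
    have pk: "pv u (k - 1) + v (u k) = pv u k" using pv_pred k(3) by simp
    have off: "Re (pv u k) < xpos w (- Im (pv u k))"
      using tile_left_vertex_off_right_path[OF uk y(1,2,3)] unfolding pk .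
    have nR: "pe u (Suc k) \<notin> R"
    proof
      assume "pe u (Suc k) \<in> R"
      moreover have "pv u k \<in> pe u (Suc k)" by (simp add: path_edge_def)
      ultimately show False using onw off by fastforce
    qed
    have "\<not> (\<exists>z\<in>{1..n}. z < u (Suc k) \<and> rhombus \<theta> (pv u k - v z) z (u (Suc k)) \<in> T)"
    proof
      assume "\<exists>z\<in>{1..n}. z < u (Suc k) \<and> rhombus \<theta> (pv u k - v z) z (u (Suc k)) \<in> T"
      then obtain z where z: "z \<in> {1..n}" "z < u (Suc k)" "rhombus \<theta> (pv u k - v z) z (u (Suc k)) \<in> T" by blast
      have "pv u (k - 1) + v (u k) = (pv u k - v z) + v z" unfolding pk by simp
      note C = tiles_common_left_vertex[OF uk y(1,2,3) z(1) uk' z(2,3) this]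
      have "flip_tile u k \<in> T" "u k < u (Suc k)" using y C unfolding flip_tile_def by auto
      then show False using none k by blast
    qed
    then show ?case using tile[OF k(2) nR] nR unfolding diff_Suc_1 by blast
  qed
  \<comment> \<open>The tile hanging from the last edge has the bottom vertex as its left vertex,
    again a point of the right boundary.\<close>
  obtain y where y: "y \<in> {1..n}" "u n < y" "rhombus \<theta> (pv u (n - 1)) (u n) y \<in> T"
    using main[of n] a(1) by auto
  have nn: "n \<in> {1..n}" using n1 by simp
  have pn: "pv u (n - 1) + v (u n) = pv u n" using pv_pred[OF n1, of u] by simp
  have "Re (pv u n) < xpos w (- Im (pv u n))"
    using tile_left_vertex_off_right_path[OF permutes_label[OF u nn] y(1,2,3)] unfolding pn .
  then show False
    using pv_xpos[OF u le_refl n1] depth_n[OF u] xpos_ends(2)[OF u n1] xpos_ends(2)[OF w n1]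
    by (simp add: Im_pv)
qed

text \<open>The sweep keeps every path edge an edge of some tile: for \<open>id\<close> by the
  condition on the sides, afterwards because the new edges belong to the tile just crossed. The
  moment decreases, so the sweep ends, and it can end only at \<open>w\<close>.\<close>

lemma sweep_induct [case_names id flip]:
  assumes id: "P id"
    and step: "\<And>u k. u permutes {1..n} \<Longrightarrow> P u \<Longrightarrow> 1 \<le> k \<Longrightarrow> k < n \<Longrightarrow> u k < u (Suc k) \<Longrightarrow>
      flip_tile u k \<in> T \<Longrightarrow> P (swap_adj u k)"
  shows "P w"
proof -
  have "P w" if "u permutes {1..n}" "P u" "\<And>l. l \<in> {1..n} \<Longrightarrow> \<exists>S\<in>T. pe u l edge_of S" for u
    using that
  proof (induction "label_moment n u" arbitrary: u rule: less_induct)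
    case less
    show ?case
    proof (cases "u = w")
      case False
      obtain k where k: "1 \<le> k" "k < n" "u k < u (Suc k)" "flip_tile u k \<in> T"
        using sweep_step[OF less.prems(1,3) False] by blast
      have "label_moment n (swap_adj u k) < label_moment n u"
        using label_moment_swap[OF k(1,2), of u] k(3) by linarith
      moreover have "\<exists>S\<in>T. pe (swap_adj u k) l edge_of S" if "l \<in> {1..n}" for l
      proof (cases "l = k \<or> l = Suc k")
        case True
        then show ?thesis using flip_tile_edges(3,4)[OF less.prems(1) k(1-3)] k(4) by blast
      next
        case False
        then have "pe (swap_adj u k) l = pe u l" using that k by (intro pe_swap) auto
        then show ?thesis using less.prems(3)[OF that] by metis
      qed
      ultimately show ?thesis
        using less.hyps[OF _ permutes_swap[OF less.prems(1) k(1,2)] step[OF less.prems(1,2) k]] by blast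
    qed (use less.prems in simp)
  qed
  from this[OF permutes_id_nat id tiling(6)] show ?thesis .
qed

section \<open>The tile at the first left edge\<close>

lemma top_left_tile:
  assumes fs: "fully_supported n w"
  obtains x where "x \<in> {1..n}" "1 < x" "rhombus \<theta> 0 1 x \<in> T"
proof -
  have l1: "1 \<in> {1..n}" using n by simp
  obtain S where S: "S \<in> T" "pe id 1 edge_of S" using tiling(6)[OF l1] by blast
  have e: "pe id 1 = closed_segment 0 (0 + v 1)" using pe_eq[of 1 id] by simp
  have nr: "pe id 1 \<notin> pe w ` {1..n}"
  proof
    assume "pe id 1 \<in> pe w ` {1..n}"
    then obtain k where "k \<in> {1..n}" "pe id 1 = pe w k" by blast
    then show False using not_side_both[OF w fs n, of k] l1 by (metis image_eqI)
  qed
  \<comment> \<open>No label is below 1, so this tile hangs down.\<close>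
  show ?thesis
  proof (rule right_tile[OF l1 S(1) S(2)[unfolded e] nr[unfolded e]])
    fix y assume "y \<in> {1..n}" "1 < y" "rhombus \<theta> 0 1 y \<in> T"
    then show ?thesis by (rule that)
  next
    fix y assume "y \<in> {1..n}" "y < 1"
    then show ?thesis by simp
  qed
qed

text \<open>The upper right side of the tile leaves the top vertex inside the polygon, so it is not
  steeper to the right than the first right side.\<close>

lemma first_label_le:
  assumes "x \<in> {1..n}" "1 < x" "rhombus \<theta> 0 1 x \<in> T"
  shows "x \<le> w 1"
proof -
  have l1: "1 \<in> {1..n}" using n by simp
  have w1: "w 1 \<in> {1..n}" using permutes_label[OF w l1] .
  \<comment> \<open>At this depth both paths from the top vertex are still on their first
    edges.\<close>
  define d where "d = min (s x) (s (w 1))"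
  have d: "d > 0" "d \<le> s x" "d \<le> s (w 1)" using s_pos[OF assms(1)] s_pos[OF w1] by (auto simp: d_def)
  define z where "z = Complex (c x * d) (- d)"
  have "z \<in> closed_segment 0 (0 + v x)"
    unfolding segment_iff[OF assms(1)] using d by (simp add: z_def off_def)
  moreover have "closed_segment 0 (0 + v x) \<subseteq> rhombus \<theta> 0 1 x"
    using rhombus_edges(3)[OF l1 assms(1,2), of 0] unfolding edge_of_def by (blast dest: face_of_imp_subset)
  ultimately have "z \<in> region w" using assms(3) tiling(3) by blast
  then have "c x * d \<le> xpos w d" unfolding region_def by (simp add: z_def)
  also have "xpos w d = c (w 1) * d"
    using xpos_piece[OF w l1, of d] d by (simp add: depth_def)
  finally have "c x \<le> c (w 1)" using d(1) by simp
  then show ?thesis using c_less_iff[OF w1 assms(1)] by linarith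
qed

text \<open>The label \<open>1\<close> leaves the front only across a tile with left vertex
  \<open>v 1\<close>, which must be the given one; so \<open>x\<close> takes its place.\<close>

lemma top_left_label_precedes_1:
  assumes x: "x \<in> {1..n}" "1 < x" "rhombus \<theta> 0 1 x \<in> T"
  shows "w 1 = 1 \<or> (\<exists>i j. 1 \<le> i \<and> i < j \<and> j \<le> n \<and> w i = x \<and> w j = 1)"
proof (induction rule: sweep_induct)
  case (flip u k)
  let ?u' = "swap_adj u k" and ?t = "Transposition.transpose k (Suc k)"
  have l1: "1 \<in> {1..n}" using n by simp
  from flip.IH show ?case
  proof (elim disjE exE conjE)
    assume u1: "u 1 = 1"
    show ?thesis
    proof (cases "k = 1")
      case True
      have u2: "u 2 \<in> {1..n}" using permutes_label[OF flip.hyps(1), of 2] n by simp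
      have "rhombus \<theta> 0 1 (u 2) \<in> T" "1 < u 2"
        using flip.hyps(4, 5) u1 True unfolding flip_tile_def by (simp_all add: numeral_2_eq_2)
      then have "u 2 = x" using tiles_common_left_vertex(3)[OF l1 u2 _ _ l1 x(1,2,3)] by simp
      then have "?u' 1 = x" "?u' 2 = 1"
        using u1 True by (simp_all add: numeral_2_eq_2)
      then show ?thesis using n by (intro disjI2 exI[of _ 1] exI[of _ 2]) simp
    next
      case False
      then have "?u' 1 = u 1" using flip.hyps(2) by (intro swap_adj_simps) auto
      then show ?thesis using u1 by metis
    qed
  next
    fix i j assume ij: "1 \<le> i" "i < j" "j \<le> n" "u i = x" "u j = 1"
    \<comment> \<open>Only ascents are exchanged and \<open>x > 1\<close>, so \<open>x\<close> and
      \<open>1\<close> never trade places; every other exchange keeps their relative order.\<close>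
    have "\<not> (i = k \<and> j = Suc k)" using flip.hyps(4) ij x(2) by auto
    then have "1 \<le> ?t i" "?t i < ?t j" "?t j \<le> n"
      using ij flip.hyps(2, 3) by (auto simp: Transposition.transpose_def)
    moreover have "?u' (?t i) = x" "?u' (?t j) = 1" using ij by simp_all
    ultimately show ?thesis by blast
  qed
qed simp

end

section \<open>Forced tiles and 321-patterns\<close>

lemma first_not_1:
  assumes "n \<ge> 2" "fully_supported n w"
  shows "w 1 \<noteq> 1"
proof
  assume "w 1 = 1"
  then have "w ` {1..1} = {1..1}" by simp
  moreover have "1 \<le> (1::nat) \<and> 1 < n" using assms(1) by simp
  ultimately show False using assms(2) unfolding fully_supported_def by blast
qed

lemma forced_if_not_321:
  assumes n: "n \<ge> 2" and w: "w permutes {1..n}" and fs: "fully_supported n w"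
    and no: "\<not> together_in_321 n w (w 1) 1"
  shows "forced_top_perimeter_tile n \<theta> w 1 (w 1)"
  unfolding forced_top_perimeter_tile_def
proof
  fix T assume T: "T \<in> rhombic_tilings n \<theta> w"
  have l1: "1 \<in> {1..n}" using n by simp
  have w1: "w 1 \<in> {1..n}" using permutes_label[OF w l1] .
  have ne: "w 1 \<noteq> 1" using first_not_1[OF n fs] .
  obtain x where x: "x \<in> {1..n}" "1 < x" "rhombus \<theta> 0 1 x \<in> T" using top_left_tile[OF n w T fs] .
  obtain i j where ij: "1 \<le> i" "i < j" "j \<le> n" "w i = x" "w j = 1"
    using top_left_label_precedes_1[OF n w T x] ne by blast
  have "x = w 1"
  proof (rule ccontr)
    assume "x \<noteq> w 1"
    then have "x < w 1" using first_label_le[OF n w T x] by simp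
    moreover have "1 < i" using ij \<open>x \<noteq> w 1\<close> by (cases "i = 1") auto
    ultimately show False
      using no ij n unfolding together_in_321_first_one_iff[OF w ne order_trans[OF one_le_numeral n]] by blast
  qed
  then have S: "rhombus \<theta> 0 1 (w 1) \<in> T" "1 < w 1" using x by auto
  have "tile_with_labels n \<theta> (rhombus \<theta> 0 1 (w 1)) 1 (w 1)"
    unfolding tile_with_labels_def using l1 w1 ne by auto
  moreover have "top_perimeter_tile \<theta> w (rhombus \<theta> 0 1 (w 1))"
    unfolding top_perimeter_tile_def
    using rhombus_edges(1,3)[OF l1 w1 S(2), of 0] pe_eq[of 1 id] pe_eq[of 1 w] by simp
  ultimately show "\<exists>S\<in>T. tile_with_labels n \<theta> S 1 (w 1) \<and> top_perimeter_tile \<theta> w S" using S by blast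
qed

lemma top_perimeter_labels:
  assumes n: "n \<ge> 2" and w: "w permutes {1..n}" and ne: "w 1 \<noteq> 1"
    and lab: "tile_with_labels n \<theta> S x y" and top: "top_perimeter_tile \<theta> w S"
  obtains p where "{x, y} = {1, w 1}" "S = rhombus \<theta> p 1 (w 1)" "p = 0 \<or> p = - v (w 1)"
proof -
  have l1: "1 \<in> {1..n}" using n by simp
  have w1: "w 1 \<in> {1..n}" using permutes_label[OF w l1] .
  obtain p i j where ij: "i \<in> {1..n}" "j \<in> {1..n}" "i < j" "{i, j} = {x, y}" and S: "S = rhombus \<theta> p i j"
    using tile_rhombus[OF lab] .
  have e1: "closed_segment 0 (0 + v 1) edge_of rhombus \<theta> p i j"
    and e2: "closed_segment 0 (0 + v (w 1)) edge_of rhombus \<theta> p i j"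
    using top pe_eq[of 1 id] pe_eq[of 1 w] unfolding top_perimeter_tile_def S by simp_all
  note c1 = rhombus_edge_cases[OF ij(1-3) l1 e1] and c2 = rhombus_edge_cases[OF ij(1-3) w1 e2]
  have "i = 1" "j = w 1" using c1 c2 ij(1,3) ne by auto
  moreover have "p = 0 \<or> p = - v j" using c1 calculation ne by (auto simp: eq_neg_iff_add_eq_0)
  ultimately show ?thesis using that[of p] ij(4) S by simp
qed

lemma not_forced_if_321:
  assumes n: "n \<ge> 2" and w: "w permutes {1..n}" and fs: "fully_supported n w"
    and tog: "together_in_321 n w (w 1) 1"
  shows "\<not> forced_top_perimeter_tile n \<theta> w x y"
proof
  assume forced: "forced_top_perimeter_tile n \<theta> w x y"
  have l1: "1 \<in> {1..n}" using n by simp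
  have w1: "w 1 \<in> {1..n}" using permutes_label[OF w l1] .
  have ne: "w 1 \<noteq> 1" using first_not_1[OF n fs] .
  obtain j l where jl: "1 < j" "j < l" "l \<le> n" "w l = 1" "w j < w 1"
    using tog unfolding together_in_321_first_one_iff[OF w ne order_trans[OF one_le_numeral n]] by blast
  \<comment> \<open>The first entry below \<open>w 1\<close> is a left-to-right minimum, and it
    differs from \<open>1\<close> because it occurs no later than \<open>w j\<close>. Passing
    through a path with this label in front gives a tile \<open>{1, z}\<close> with
    \<open>z < w 1\<close>.\<close>
  define k where "k = (LEAST k. 1 < k \<and> w k < w 1)"
  have k: "1 < k \<and> w k < w 1" unfolding k_def by (rule LeastI[of _ j]) (use jl in simp)
  have kj: "k \<le> j" unfolding k_def by (rule Least_le) (use jl in simp)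
  have small: "w k < w i" if "1 \<le> i" "i < k" for i
  proof (cases "i = 1")
    case False
    have "\<not> (1 < i \<and> w i < w 1)" using not_less_Least[OF that(2)[unfolded k_def]] .
    then show ?thesis using False that k by linarith
  qed (use k in simp)
  have "k \<noteq> l" using kj jl(2) by simp
  then have k1: "w k \<noteq> 1" using injD[OF permutes_inj[OF w], of k l] jl(4) by metis
  have kn: "1 \<le> k" "k \<le> n" using k kj jl(2,3) by linarith+
  obtain T z where T: "flips w T" "1 < z" "z \<le> w k" "rhombus \<theta> 0 1 z \<in> T"
    using flips_through_front[OF kn w k1 small] by blast
  have tl: "T \<in> rhombic_tilings n \<theta> w" using flips_rhombic_tiling[OF T(1) n w fs] .
  obtain S where S: "S \<in> T" "tile_with_labels n \<theta> S x y" "top_perimeter_tile \<theta> w S"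
    using forced tl unfolding forced_top_perimeter_tile_def by blast
  obtain p where p: "S = rhombus \<theta> p 1 (w 1)" "p = 0 \<or> p = - v (w 1)"
    using top_perimeter_labels[OF n w ne S(2,3)] .
  have lt: "1 < w 1" using w1 ne by auto
  have "p \<in> S" unfolding p(1) rhombus_def by (rule hull_inc) simp
  \<comment> \<open>The position \<open>p = - v (w 1)\<close> would place the top of the tile above
    the polygon. With \<open>p = 0\<close> the tile shares the left vertex \<open>v 1\<close> with
    \<open>{1, z}\<close>.\<close>
  then have "p \<in> region w" using S(1) tiling(3)[OF n w tl] by blast
  then have "Im p \<le> 0" unfolding region_def by simp
  then have "p = 0" using p(2) Im_v[of "w 1"] s_pos[OF w1] by (auto simp del: cis.simps)
  have z: "z \<in> {1..n}" using T(2,3) k w1 by auto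
  have "w 1 = z"
    using tiles_common_left_vertex(3)[OF n w tl l1 w1 lt _ l1 z T(2,4), of 0] S(1) p(1) \<open>p = 0\<close> by simp
  then show False using T(3) k by simp
qed

text \<open>Forcedness quantifies over all tilings, so it pins the labels only because a tiling
  exists.\<close>

lemma forced_labels:
  assumes n: "n \<ge> 2" and w: "w permutes {1..n}" and fs: "fully_supported n w"
    and forced: "forced_top_perimeter_tile n \<theta> w x y"
  shows "{x, y} = {1, w 1}"
proof -
  obtain T where "flips w T" using flips_exists[OF w] by blast
  then have "T \<in> rhombic_tilings n \<theta> w" using flips_rhombic_tiling n w fs by blast
  then obtain S where "tile_with_labels n \<theta> S x y" "top_perimeter_tile \<theta> w S"
    using forced unfolding forced_top_perimeter_tile_def by blast
  then show ?thesis using top_perimeter_labels[OF n w first_not_1[OF n fs]] by blast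
qed

end

theorem theorem4p11:
  fixes n :: nat and w :: "nat \<Rightarrow> nat" and \<theta> :: "nat \<Rightarrow> real"
  assumes "n \<ge> 2" and "w permutes {1..n}" and "fully_supported n w"
    and "elnitsky_angles n \<theta>"
  shows "((\<exists>x y. forced_top_perimeter_tile n \<theta> w x y) \<longleftrightarrow> \<not> together_in_321 n w (w 1) 1) \<and>
    (\<not> together_in_321 n w (w 1) 1 \<longleftrightarrow> first_ltr_min_after_first n w 1) \<and>
    (\<forall>x y. forced_top_perimeter_tile n \<theta> w x y \<longrightarrow> {x, y} = {1, w 1})"
proof -
  interpret elnitsky n \<theta> using assms(4) by unfold_locales
  note h = assms(1-3)
  have "n \<ge> 1" using assms(1) by simp
  note iff = not_together_in_321_iff_first_ltr_min[OF assms(2) first_not_1[OF assms(1,3)] this]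
  show ?thesis
    using forced_if_not_321[OF h] not_forced_if_321[OF h] forced_labels[OF h] iff by blast
qed

end
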